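(* Let $a\in A(\bar F)$. Then $r(d_{c(a)})$ is the unique dominant element in the $W$-orbit of $\nu_a$.
   Context: Field: $\mathcal O$ is a complete discrete valuation ring with uniformizer $\pi$ and algebraically closed residue field $k=\mathcal O/\pi\mathcal O$; $F$ is its fraction field and $\bar F$ an algebraic closure. The convention is the negative of the usual valuation: $\mathrm{val}:F^\times\to\mathbb Z$ is normalized by $\mathrm{val}(\pi)=-1$, extended to $\mathrm{val}:\bar F^\times\to\mathbb Q$, with $\mathrm{val}(0)=-\infty$ (so $\mathrm{val}(a+b)\le\max\{\mathrm{val}(a),\mathrm{val}(b)\}$). Group: $G$ is a split connected reductive group over $\mathcal O$ with simply connected derived group $G_{\mathrm{sc}}$; $A\subset B$ are a split maximal torus and a Borel subgroup (over $\mathcal O$); $W$ is the Weyl group of $A$ in $G$; $D=G/G_{\mathrm{sc}}$ (a split torus), $A_{\mathrm{sc}}=A\cap G_{\mathrm{sc}}$, so that $0\to X^*(D)\to X^*(A)\to X^*(A_{\mathrm{sc}})\to 0$ is exact. $\alpha_1,\dots,\alpha_l$ are the simple roots, $\alpha_1^\vee,\dots,\alpha_l^\vee$ the simple coroots (a $\mathbb Z$-basis of $X_*(A_{\mathrm{sc}})$), $\varpi_1,\dots,\varpi_l\in X^*(A_{\mathrm{sc}})$ the dual basis (fundamental weights). For $1\le i\le l$, $\omega_i\in X^*(A)$ is a chosen extension of $\varpi_i$ to $A$, and $\omega_{l+1},\dots,\omega_n$ is a chosen basis of $X^*(D)$, where $n=\dim A$; then $\omega_1,\dots,\omega_n$ is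 a $\mathbb Z$-basis of $X^*(A)$. $\mathfrak a=X_*(A)\otimes\mathbb R$, $\mathfrak a_{\mathbb Q}=X_*(A)\otimes\mathbb Q$, with a fixed $W$-invariant Euclidean inner product on $\mathfrak a$. $x\in\mathfrak a$ is dominant if $\langle\alpha_i,x\rangle\ge0$ for $1\le i\le l$; $\mathfrak a_{\mathrm{dom}}$ is the set of dominant elements. Map $r$: for $x\in\mathfrak a$, $r(x)$ is the unique point of $\mathfrak a_{\mathrm{dom}}$ closest to $x$. Identify $\mathfrak a$ with $\mathbb R^n$ by $x\mapsto(\langle\omega_1,x\rangle,\dots,\langle\omega_n,x\rangle)$. Let $\tilde{\mathbb R}=\mathbb R\cup\{-\infty\}$, with the intervals $[-\infty,a)$ as neighborhood base at $-\infty$. The map $r:\mathbb R^n\to\mathfrak a_{\mathrm{dom}}$ extends (uniquely) to a continuous map, still called $r$, $\tilde{\mathbb R}^l\times\mathbb R^{n-l}\to\mathfrak a_{\mathrm{dom}}$. Adjoint quotient: for $\lambda\in X^*(A)$ write $e^\lambda$ for $\lambda$ viewed as a regular function on $A$. Put $c_i=\sum_{\lambda\in W\omega_i}e^\lambda$ (sum over the Weyl group orbit of $\omega_i$), for $i=1,\dots,n$. The map $c=(c_1,\dots,c_n):A\to\mathbb A:=\mathbb A^l\times\mathbb G_m^{n-l}$ identifies $A/W$ with $\mathbb A^l\times\mathbb G_m^{n-l}$. For $a\in A(\bar F)$, $\nu_a\in\mathfrak a_{\mathbb Q}$ is defined by $\langle\lambda,\nu_a\rangle=\mathrm{val}\,\lambda(a)$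 for all $\lambda\in X^*(A)$. For $c=(c_1,\dots,c_n)\in\bar F^l\times(\bar F^\times)^{n-l}=\mathbb A(\bar F)$, put $d_c=(\mathrm{val}\,c_1,\dots,\mathrm{val}\,c_n)\in(\mathbb Q\cup\{-\infty\})^l\times\mathbb Q^{n-l}$. *)

theory Defs
  imports "HOL-Analysis.Analysis" "HOL-Algebra.Algebraic_Closure_Type"
begin

section \<open>Abelian groups as modules over the integers\<close>

definition zsmul :: "int \<Rightarrow> 'a::ab_group_add \<Rightarrow> 'a" where
  "zsmul k x = (\<Sum>i<nat k. x) - (\<Sum>i<nat (- k). x)"

lemma zsmul_eq:
  fixes x :: "'a::ab_group_add"
  assumes "k = int m - int p"
  shows "zsmul k x = (\<Sum>i<m. x) - (\<Sum>i<p. x)"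
proof -
  have split: "(\<Sum>i<q + s. x) = (\<Sum>i<q. x) + (\<Sum>i<s. x)" for q s :: nat
    by (induction s) (simp_all add: algebra_simps)
  have "nat k + p = m + nat (- k)" using assms by linarith
  then have "(\<Sum>i<nat k. x) + (\<Sum>i<p. x) = (\<Sum>i<m. x) + (\<Sum>i<nat (- k). x)"
    by (metis split)
  then show ?thesis by (simp add: zsmul_def algebra_simps)
qed

lemma zsmul_add_left: "zsmul (j + k) x = zsmul j x + zsmul k x"
proof -
  have split: "(\<Sum>i<q + s. x) = (\<Sum>i<q. x) + (\<Sum>i<s. x)" for q s :: nat
    by (induction s) (simp_all add: algebra_simps)
  have "j + k = int (nat j + nat k) - int (nat (- j) + nat (- k))" by linarith
  from zsmul_eq[OF this, of x] show ?thesis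
    by (simp add: split zsmul_def)
qed

lemma zsmul_add_right: "zsmul k (x + y) = zsmul k x + zsmul k y"
  by (simp add: zsmul_def sum.distrib)

lemma zsmul_one: "zsmul 1 x = x"
  by (simp add: zsmul_def)

lemma zsmul_zero: "zsmul 0 x = 0"
  by (simp add: zsmul_def)

lemma zsmul_minus: "zsmul (- k) x = - zsmul k x"
  by (simp add: zsmul_def)

lemma zsmul_mult: "zsmul j (zsmul k x) = zsmul (j * k) x"
proof -
  have nonneg: "zsmul (int m) (zsmul k x) = zsmul (int m * k) x" for m
    by (induction m) (simp_all add: zsmul_zero zsmul_add_left zsmul_one distrib_right)
  show ?thesis
  proof (cases "0 \<le> j")
    case True
    then show ?thesis using nonneg[of "nat j"] by simp
  next
    case False
    then have "j = - int (nat (- j))" by simp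
    then show ?thesis using nonneg[of "nat (- j)"] zsmul_minus by (metis minus_mult_left)
  qed
qed

global_interpretation zmod: Modules.module "zsmul :: int \<Rightarrow> 'a::ab_group_add \<Rightarrow> 'a"
  by unfold_locales (simp_all add: zsmul_add_left zsmul_add_right zsmul_one zsmul_mult)

definition z_basis_of :: "'a::ab_group_add set \<Rightarrow> 'a set \<Rightarrow> bool" where
  "z_basis_of B M \<longleftrightarrow> \<not> zmod.dependent B \<and> zmod.span B = M"


section \<open>The valued field\<close>

text \<open>The type \<open>'o\<close> is the ring, \<open>'o fract\<close> its fraction field and
  \<open>'o fract alg_closure\<close> an algebraic closure of the latter.\<close>

locale complete_dvr =
  fixes \<pi> :: "'o::idom"
  assumes pid: "principal_domain (ring_of_type_algebra :: 'o ring)"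
    and local: "{I. maximalideal I (ring_of_type_algebra :: 'o ring)} =
                {cgenideal ring_of_type_algebra \<pi>}"
    and not_field: "\<pi> \<noteq> 0"
    and complete: "\<And>s :: nat \<Rightarrow> 'o.
      (\<forall>m. \<exists>N. \<forall>i\<ge>N. \<forall>j\<ge>N. \<pi> ^ m dvd s i - s j) \<Longrightarrow>
      (\<exists>t. \<forall>m. \<exists>N. \<forall>i\<ge>N. \<pi> ^ m dvd s i - t)"
    and residue_field: "algebraically_closed
      (FactRing (ring_of_type_algebra :: 'o ring) (cgenideal ring_of_type_algebra \<pi>))"

text \<open>The negative of the usual valuation. The number \<open>v x\<close> is only meaningful for
  \<open>x \<noteq> 0\<close>; by multiplicativity the last assumption determines \<open>v\<close> on
  the nonzero elements of the fraction field.\<close>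

locale neg_valuation = complete_dvr \<pi> for \<pi> :: "'o::idom" +
  fixes v :: "'o fract alg_closure \<Rightarrow> rat"
  assumes v_mult: "\<And>x y. x \<noteq> 0 \<Longrightarrow> y \<noteq> 0 \<Longrightarrow> v (x * y) = v x + v y"
    and v_add: "\<And>x y. x \<noteq> 0 \<Longrightarrow> y \<noteq> 0 \<Longrightarrow> x + y \<noteq> 0 \<Longrightarrow>
                  v (x + y) \<le> max (v x) (v y)"
    and v_normalized: "\<And>u k. u dvd 1 \<Longrightarrow> v (to_ac (to_fract (u * \<pi> ^ k))) = - of_nat k"

definition val :: "('f::zero \<Rightarrow> rat) \<Rightarrow> 'f \<Rightarrow> ereal" where
  "val v x = (if x = 0 then - \<infinity> else ereal (of_rat (v x)))"


section \<open>Root data\<close>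

text \<open>A split connected reductive group together with a split maximal torus \<open>A\<close> is
  given by its reduced root datum: \<open>'x\<close> is \<open>X\<^sup>*(A)\<close>, \<open>'y\<close> is \<open>X\<^sub>*(A)\<close>,
  \<open>n\<close> is \<open>dim A\<close>. A Borel subgroup containing \<open>A\<close> is given by its
  simple roots \<open>\<alpha> 1, \<dots>, \<alpha> l\<close>.\<close>

definition reflection ::
  "('x::ab_group_add \<Rightarrow> 'y \<Rightarrow> int) \<Rightarrow> ('x \<Rightarrow> 'y) \<Rightarrow> 'x \<Rightarrow> 'x \<Rightarrow> 'x" where
  "reflection pr coroot \<beta> \<mu> = \<mu> - zsmul (pr \<mu> (coroot \<beta>)) \<beta>"

definition coreflection ::
  "('x \<Rightarrow> 'y::ab_group_add \<Rightarrow> int) \<Rightarrow> ('x \<Rightarrow> 'y) \<Rightarrow> 'x \<Rightarrow> 'y \<Rightarrow> 'y" where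
  "coreflection pr coroot \<beta> y = y - zsmul (pr \<beta> y) (coroot \<beta>)"

locale root_datum =
  fixes pr :: "'x::ab_group_add \<Rightarrow> 'y::ab_group_add \<Rightarrow> int"
    and roots :: "'x set"
    and coroot :: "'x \<Rightarrow> 'y"
    and n :: nat
  assumes free: "\<exists>B :: 'x set. finite B \<and> card B = n \<and> z_basis_of B UNIV"
    and pr_add_left: "\<And>\<mu> \<mu>' y. pr (\<mu> + \<mu>') y = pr \<mu> y + pr \<mu>' y"
    and pr_add_right: "\<And>\<mu> y y'. pr \<mu> (y + y') = pr \<mu> y + pr \<mu> y'"
    and perfect_left: "\<And>f. Modules.additive f \<Longrightarrow> \<exists>!\<mu>. \<forall>y. f y = pr \<mu> y"
    and perfect_right: "\<And>f. Modules.additive f \<Longrightarrow> \<exists>!y. \<forall>\<mu>. f \<mu> = pr \<mu> y"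
    and finite_roots: "finite roots"
    and inj_coroot: "inj_on coroot roots"
    and pr_root_coroot: "\<And>\<beta>. \<beta> \<in> roots \<Longrightarrow> pr \<beta> (coroot \<beta>) = 2"
    and reflection_roots: "\<And>\<beta>. \<beta> \<in> roots \<Longrightarrow> reflection pr coroot \<beta> ` roots = roots"
    and coreflection_coroots: "\<And>\<beta>. \<beta> \<in> roots \<Longrightarrow>
          coreflection pr coroot \<beta> ` coroot ` roots = coroot ` roots"
    and reduced: "\<And>\<beta> \<gamma> j k. \<beta> \<in> roots \<Longrightarrow> \<gamma> \<in> roots \<Longrightarrow> j \<noteq> 0 \<Longrightarrow>
          zsmul j \<gamma> = zsmul k \<beta> \<Longrightarrow> \<gamma> = \<beta> \<or> \<gamma> = - \<beta>"

locale based_root_datum = root_datum pr roots coroot n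
  for pr :: "'x::ab_group_add \<Rightarrow> 'y::ab_group_add \<Rightarrow> int"
    and roots :: "'x set" and coroot :: "'x \<Rightarrow> 'y" and n :: nat +
  fixes \<alpha> :: "nat \<Rightarrow> 'x" and l :: nat
  assumes inj_simple: "inj_on \<alpha> {1..l}"
    and simple_roots: "\<alpha> ` {1..l} \<subseteq> roots"
    and simple_independent: "\<not> zmod.dependent (\<alpha> ` {1..l})"
    and pos_or_neg: "\<And>\<beta>. \<beta> \<in> roots \<Longrightarrow> \<exists>m :: nat \<Rightarrow> nat.
          \<beta> = (\<Sum>i\<in>{1..l}. zsmul (int (m i)) (\<alpha> i)) \<or>
          \<beta> = - (\<Sum>i\<in>{1..l}. zsmul (int (m i)) (\<alpha> i))"

definition coroot_lattice :: "'x set \<Rightarrow> ('x \<Rightarrow> 'y::ab_group_add) \<Rightarrow> 'y set" where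
  "coroot_lattice roots coroot = zmod.span (coroot ` roots)"

text \<open>Cocharacters of the maximal torus \<open>A\<^bsub>sc\<^esub>\<close> of the derived group: the
  saturation of the coroot lattice. The derived group is simply connected iff they are all
  in the coroot lattice.\<close>

definition derived_cocharacters :: "'x set \<Rightarrow> ('x \<Rightarrow> 'y::ab_group_add) \<Rightarrow> 'y set" where
  "derived_cocharacters roots coroot =
     {y. \<exists>k. k \<noteq> 0 \<and> zsmul k y \<in> coroot_lattice roots coroot}"

definition sc_derived :: "'x set \<Rightarrow> ('x \<Rightarrow> 'y::ab_group_add) \<Rightarrow> bool" where
  "sc_derived roots coroot \<longleftrightarrow>
     derived_cocharacters roots coroot = coroot_lattice roots coroot"

text \<open>\<open>X\<^sup>*(D)\<close>, the kernel of \<open>X\<^sup>*(A) \<rightarrow> X\<^sup>*(A\<^bsub>sc\<^esub>)\<close>.\<close>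

definition D_characters ::
  "('x \<Rightarrow> 'y::ab_group_add \<Rightarrow> int) \<Rightarrow> 'x set \<Rightarrow> ('x \<Rightarrow> 'y) \<Rightarrow> 'x set" where
  "D_characters pr roots coroot =
     {\<mu>. \<forall>y \<in> derived_cocharacters roots coroot. pr \<mu> y = 0}"

locale adapted_weights = based_root_datum pr roots coroot n \<alpha> l
  for pr :: "'x::ab_group_add \<Rightarrow> 'y::ab_group_add \<Rightarrow> int"
    and roots :: "'x set" and coroot :: "'x \<Rightarrow> 'y" and n :: nat
    and \<alpha> :: "nat \<Rightarrow> 'x" and l :: nat +
  fixes \<omega> :: "nat \<Rightarrow> 'x"
  assumes sc: "sc_derived roots coroot"
    and fundamental: "\<And>i j. i \<in> {1..l} \<Longrightarrow> j \<in> {1..l} \<Longrightarrow>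
          pr (\<omega> i) (coroot (\<alpha> j)) = of_bool (i = j)"
    and inj_central: "inj_on \<omega> {l+1..n}"
    and central: "z_basis_of (\<omega> ` {l+1..n}) (D_characters pr roots coroot)"

inductive_set weyl_group ::
  "('x::ab_group_add \<Rightarrow> 'y \<Rightarrow> int) \<Rightarrow> 'x set \<Rightarrow> ('x \<Rightarrow> 'y) \<Rightarrow> ('x \<Rightarrow> 'x) set"
  for pr roots coroot where
  one: "id \<in> weyl_group pr roots coroot"
| step: "w \<in> weyl_group pr roots coroot \<Longrightarrow> \<beta> \<in> roots \<Longrightarrow>
          reflection pr coroot \<beta> \<circ> w \<in> weyl_group pr roots coroot"


section \<open>The real vector space\<close>

text \<open>\<open>'v\<close> is \<open>X\<^sub>*(A) \<otimes> \<real>\<close> with canonical map \<open>\<iota>\<close> and extended pairing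
  \<open>rp\<close>: compatibility with the perfect pairing forces the canonical linear map from the
  tensor product to be injective, the span condition forces it to be surjective. The inner
  product is the one of the type class; \<open>heine_borel\<close> only says that the dimension
  is finite (the class \<open>euclidean_space\<close> would exclude dimension zero).\<close>

definition weyl_act :: "('x \<Rightarrow> 'v \<Rightarrow> real) \<Rightarrow> ('x \<Rightarrow> 'x) \<Rightarrow> 'v \<Rightarrow> 'v" where
  "weyl_act rp w x = (THE y. \<forall>\<mu>. rp (w \<mu>) y = rp \<mu> x)"

locale real_cocharacters = root_datum pr roots coroot n
  for pr :: "'x::ab_group_add \<Rightarrow> 'y::ab_group_add \<Rightarrow> int"
    and roots :: "'x set" and coroot :: "'x \<Rightarrow> 'y" and n :: nat +
  fixes \<iota> :: "'y \<Rightarrow> 'v::{real_inner, heine_borel}"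
    and rp :: "'x \<Rightarrow> 'v \<Rightarrow> real"
  assumes iota_add: "\<And>y y'. \<iota> (y + y') = \<iota> y + \<iota> y'"
    and rp_linear: "\<And>\<mu>. linear (rp \<mu>)"
    and rp_iota: "\<And>\<mu> y. rp \<mu> (\<iota> y) = of_int (pr \<mu> y)"
    and span_iota: "span (range \<iota>) = (UNIV :: 'v set)"
    and weyl_invariant: "\<And>w x y. w \<in> weyl_group pr roots coroot \<Longrightarrow>
          inner (weyl_act rp w x) (weyl_act rp w y) = inner x y"

definition dominant :: "('x \<Rightarrow> 'v \<Rightarrow> real) \<Rightarrow> (nat \<Rightarrow> 'x) \<Rightarrow> nat \<Rightarrow> 'v set" where
  "dominant rp \<alpha> l = {x. \<forall>i\<in>{1..l}. 0 \<le> rp (\<alpha> i) x}"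

definition retraction_dom ::
  "('x \<Rightarrow> 'v \<Rightarrow> real) \<Rightarrow> (nat \<Rightarrow> 'x) \<Rightarrow> nat \<Rightarrow> 'v \<Rightarrow> 'v::{real_inner, heine_borel}" where
  "retraction_dom rp \<alpha> l x = closest_point (dominant rp \<alpha> l) x"

text \<open>Points of \<open>n\<close>-dimensional (extended) real space are functions on \<open>nat\<close> that
  vanish outside \<open>{1..n}\<close>.\<close>

definition coords :: "('x \<Rightarrow> 'v \<Rightarrow> real) \<Rightarrow> (nat \<Rightarrow> 'x) \<Rightarrow> nat \<Rightarrow> 'v \<Rightarrow> nat \<Rightarrow> ereal" where
  "coords rp \<omega> n x = (\<lambda>i. if i \<in> {1..n} then ereal (rp (\<omega> i) x) else 0)"

definition extended_space :: "nat \<Rightarrow> nat \<Rightarrow> (nat \<Rightarrow> ereal) set" where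
  "extended_space l n =
     {d. (\<forall>i\<in>{1..l}. d i \<noteq> \<infinity>) \<and> (\<forall>i\<in>{l+1..n}. \<bar>d i\<bar> \<noteq> \<infinity>) \<and>
         (\<forall>i. i \<notin> {1..n} \<longrightarrow> d i = 0)}"

definition extended_retraction ::
  "('x \<Rightarrow> 'v \<Rightarrow> real) \<Rightarrow> (nat \<Rightarrow> 'x) \<Rightarrow> nat \<Rightarrow> (nat \<Rightarrow> 'x) \<Rightarrow> nat \<Rightarrow>
     (nat \<Rightarrow> ereal) \<Rightarrow> 'v::{real_inner, heine_borel}" where
  "extended_retraction rp \<alpha> l \<omega> n =
     (THE R. R \<in> extended_space l n \<rightarrow>\<^sub>E dominant rp \<alpha> l \<and>
             continuous_on (extended_space l n) R \<and>
             (\<forall>x. R (coords rp \<omega> n x) = retraction_dom rp \<alpha> l x))"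


section \<open>Points of the torus and the adjoint quotient\<close>

text \<open>\<open>A(K) = Hom (X\<^sup>*(A), K\<^sup>\<times>)\<close> for a field \<open>K\<close>, so that \<open>a \<mu>\<close> is the value at
  \<open>a\<close> of the character \<open>\<mu>\<close>.\<close>

definition torus_points :: "('x::ab_group_add \<Rightarrow> 'f::field) set" where
  "torus_points = {a. (\<forall>\<mu>. a \<mu> \<noteq> 0) \<and> (\<forall>\<mu> \<mu>'. a (\<mu> + \<mu>') = a \<mu> * a \<mu>')}"

definition nu :: "('x \<Rightarrow> 'v \<Rightarrow> real) \<Rightarrow> ('f \<Rightarrow> rat) \<Rightarrow> ('x \<Rightarrow> 'f) \<Rightarrow> 'v" where
  "nu rp v a = (THE x. \<forall>\<mu>. rp \<mu> x = of_rat (v (a \<mu>)))"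

definition adjoint_quotient ::
  "('x::ab_group_add \<Rightarrow> 'y \<Rightarrow> int) \<Rightarrow> 'x set \<Rightarrow> ('x \<Rightarrow> 'y) \<Rightarrow> (nat \<Rightarrow> 'x) \<Rightarrow>
     ('x \<Rightarrow> 'f::field) \<Rightarrow> nat \<Rightarrow> 'f" where
  "adjoint_quotient pr roots coroot \<omega> a i =
     (\<Sum>\<mu>\<in>(\<lambda>w. w (\<omega> i)) ` weyl_group pr roots coroot. a \<mu>)"

definition d_point :: "('f::zero \<Rightarrow> rat) \<Rightarrow> nat \<Rightarrow> (nat \<Rightarrow> 'f) \<Rightarrow> nat \<Rightarrow> ereal" where
  "d_point v n c = (\<lambda>i. if i \<in> {1..n} then val v (c i) else 0)"

end

theory Submission
  imports Defs
begin

text \<open>Move \<open>\<nu>\<^sub>a\<close> by the Weyl group to a dominant point \<open>x\<close>. The characters in the orbit of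
  \<open>\<omega>\<^sub>i\<close> take values of valuation \<open>\<langle>\<lambda>, x\<rangle>\<close> at \<open>a\<close>, where \<open>\<lambda>\<close> runs through the same orbit. Since
  \<open>\<omega>\<^sub>i\<close> and \<open>x\<close> are dominant, all of these are at most \<open>\<langle>\<omega>\<^sub>i, x\<rangle>\<close>, so the \<open>i\<close>-th coordinate of
  \<open>d = d\<^bsub>c(a)\<^esub>\<close> is at most \<open>\<langle>\<omega>\<^sub>i, x\<rangle>\<close>. If \<open>\<langle>\<alpha>\<^sub>i, x\<rangle> > 0\<close>, then the bound is attained by
  \<open>\<lambda> = \<omega>\<^sub>i\<close> alone, nothing can cancel, and the coordinate is exactly \<open>\<langle>\<omega>\<^sub>i, x\<rangle>\<close>. For \<open>i > l\<close> the orbit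
  has one element and there is equality as well (\<open>val_orbit_sum_le\<close>, \<open>val_orbit_sum_eq\<close>,
  \<open>val_central_sum\<close>).

  For finite \<open>d\<close> this says that \<open>d = x - \<Sum>i\<le>l. t\<^sub>i \<alpha>\<^sub>i\<^sup>\<or>\<close> with \<open>t\<^sub>i \<ge> 0\<close>, and \<open>t\<^sub>i > 0\<close> only for walls
  that contain \<open>x\<close>. These are the optimality conditions for \<open>x\<close> to be the dominant point
  closest to \<open>d\<close> (\<open>retraction_eqI\<close>, with the converse \<open>retraction_optimality\<close>). Such a description
  of \<open>x\<close> by \<open>d\<close> determines \<open>x\<close>; hence the orbit contains only one dominant point.

  A coordinate \<open>-\<infinity>\<close> is handled by an explicit formula for the extension of \<open>r\<close>. The simple roots
  form obtuse angles, so that \<open>\<langle>\<omega>\<^sub>i, y\<rangle>\<close> is bounded below on the dominant points \<open>y\<close> with given central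
  coordinates. Raising smaller coordinates of \<open>d\<close> to this bound preserves the optimality
  conditions. The closest point to the raised, finite point is therefore a continuous function of \<open>d\<close>
  that extends \<open>r\<close>; by density of the finite points it is the only such extension
  (\<open>extended_retraction_eq\<close>).

  The facts on orbits are proved for reflection groups of Euclidean root systems. The key one,
  that \<open>u - w u\<close> is a nonnegative combination of simple roots when \<open>u\<close> is dominant
  (\<open>dominant_mirror_group_le\<close>), rests on the exchange condition for words in the simple reflections. The
  invariant inner product carries the root datum over to such a root system: it turns each character
  \<open>\<mu>\<close> into a vector, and each coroot becomes \<open>2 / (\<beta> \<bullet> \<beta>)\<close> times the vector of its root \<open>\<beta>\<close>
  (\<open>coroot_vector\<close>).\<close>


section \<open>Finite-dimensional inner product spaces\<close>

lemma orthogonal_spanning_set: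
  fixes B :: "'v::real_inner set"
  assumes "finite B"
  obtains C where "finite C" "span C = span B" "pairwise orthogonal C" "0 \<notin> C"
proof -
  obtain C where C: "finite C" "span C = span B" "pairwise orthogonal C"
    using basis_orthogonal[OF assms] by blast
  show ?thesis
  proof (rule that[of "C - {0}"])
    show "span (C - {0}) = span B" using C by simp
    show "pairwise orthogonal (C - {0})" using C(3) by (rule pairwise_subset) auto
  qed (use C in auto)
qed

lemma inner_orthogonal_expansion:
  fixes C :: "'v::real_inner set"
  assumes "finite C" "pairwise orthogonal C" "0 \<notin> C" "b \<in> C"
  shows "(\<Sum>c\<in>C. (k c / (c \<bullet> c)) *\<^sub>R c) \<bullet> b = k b"
proof -
  have "(\<Sum>c\<in>C. (k c / (c \<bullet> c)) *\<^sub>R c) \<bullet> b = (\<Sum>c\<in>C. if c = b then k b else 0)"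
    unfolding inner_sum_left
    by (rule sum.cong) (use assms in \<open>auto simp: pairwise_def orthogonal_def\<close>)
  also have "\<dots> = k b" using assms by simp
  finally show ?thesis .
qed

lemma linear_functional_representer:
  fixes B :: "'v::real_inner set"
    and \<phi> :: "'v \<Rightarrow> real"
  assumes "finite B" "span B = UNIV" "linear \<phi>"
  obtains f where "\<And>x. f \<bullet> x = \<phi> x"
proof -
  obtain C where C: "finite C" "span C = span B" "pairwise orthogonal C" "0 \<notin> C"
    using orthogonal_spanning_set[OF assms(1)] by blast
  define f where "f = (\<Sum>c\<in>C. (\<phi> c / (c \<bullet> c)) *\<^sub>R c)"
  have "f \<bullet> x = \<phi> x" for x
  proof (rule linear_eq_on_span[of "\<lambda>x. f \<bullet> x" \<phi> C])
    show "linear ((\<bullet>) f)" by (simp add: bounded_linear.linear bounded_linear_inner_right)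
    show "f \<bullet> b = \<phi> b" if "b \<in> C" for b
      unfolding f_def using inner_orthogonal_expansion[OF C(1,3,4) that] .
  qed (use assms C in auto)
  then show ?thesis by (rule that)
qed

lemma orthogonal_projection_off_span:
  fixes B :: "'v::real_inner set"
  assumes "finite B"
  obtains p where "x - p \<in> span B" "\<And>b. b \<in> span B \<Longrightarrow> p \<bullet> b = 0"
proof -
  obtain C where C: "finite C" "span C = span B" "pairwise orthogonal C" "0 \<notin> C"
    using orthogonal_spanning_set[OF assms] by blast
  define q where "q = (\<Sum>c\<in>C. ((x \<bullet> c) / (c \<bullet> c)) *\<^sub>R c)"
  have qin: "q \<in> span B"
    unfolding q_def C(2)[symmetric] by (intro span_sum span_scale span_base)
  have perp: "(x - q) \<bullet> b = 0" if "b \<in> C" for b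
    using inner_orthogonal_expansion[OF C(1,3,4) that, of "\<lambda>c. x \<bullet> c"]
    by (simp add: q_def inner_diff_left)
  have "(x - q) \<bullet> b = 0" if "b \<in> span B" for b
  proof (rule linear_eq_on_span[of "\<lambda>b. (x - q) \<bullet> b" "\<lambda>_. 0" C])
    show "linear ((\<bullet>) (x - q))" by (simp add: bounded_linear.linear bounded_linear_inner_right)
    show "linear (\<lambda>_::'v. 0::real)" by (simp add: linear_iff)
  qed (use perp that C in auto)
  with qin show ?thesis by (intro that[of "x - q"]) auto
qed


section \<open>Reflection groups of Euclidean root systems\<close>

text \<open>For \<open>\<beta> = 0\<close> the quotient is \<open>0\<close>, so that \<open>mirror 0\<close> is the identity and the isometry laws hold
  for every \<open>\<beta>\<close>.\<close>

definition mirror :: "'v::real_inner \<Rightarrow> 'v \<Rightarrow> 'v" where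
  "mirror \<beta> x = x - (2 * (x \<bullet> \<beta>) / (\<beta> \<bullet> \<beta>)) *\<^sub>R \<beta>"

inductive_set mirror_group :: "'v::real_inner set \<Rightarrow> ('v \<Rightarrow> 'v) set" for \<Phi> where
  one: "id \<in> mirror_group \<Phi>"
| step: "w \<in> mirror_group \<Phi> \<Longrightarrow> \<beta> \<in> \<Phi> \<Longrightarrow> mirror \<beta> \<circ> w \<in> mirror_group \<Phi>"

lemma linear_mirror: "linear (mirror \<beta>)"
  by (rule linearI) (simp_all add: mirror_def algebra_simps inner_add_left add_divide_distrib)

lemma mirror_inner: "mirror \<beta> x \<bullet> mirror \<beta> y = x \<bullet> y"
  by (simp add: mirror_def inner_diff_left inner_diff_right inner_commute)

lemma mirror_mirror [simp]: "mirror \<beta> (mirror \<beta> x) = x"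
proof (cases "\<beta> = 0")
  case False
  then have "mirror \<beta> x \<bullet> \<beta> = - (x \<bullet> \<beta>)"
    by (simp add: mirror_def inner_diff_left)
  then show ?thesis by (simp add: mirror_def[of \<beta> "mirror \<beta> x"]) (simp add: mirror_def)
qed (simp add: mirror_def)

lemma mirror_self: "\<beta> \<noteq> 0 \<Longrightarrow> mirror \<beta> \<beta> = - \<beta>"
  by (simp add: mirror_def algebra_simps scaleR_2)

lemma mirror_uminus_left: "mirror (- \<beta>) = mirror \<beta>"
  by (rule ext) (simp add: mirror_def)

lemma mirror_inner_swap: "mirror \<beta> x \<bullet> y = x \<bullet> mirror \<beta> y"
  using mirror_inner[of \<beta> x "mirror \<beta> y"] by simp

lemma mirror_conjugate: "mirror \<beta> (mirror \<gamma> (mirror \<beta> x)) = mirror (mirror \<beta> \<gamma>) x"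
  unfolding mirror_def[of \<gamma>] mirror_def[of "mirror \<beta> \<gamma>"]
  using linear_mirror[of \<beta>]
  by (simp add: linear_diff linear_scale mirror_inner mirror_inner_swap)

lemma linear_mirror_group: "w \<in> mirror_group \<Phi> \<Longrightarrow> linear w"
  by (induction rule: mirror_group.induct) (blast intro: linear_compose linear_mirror linear_id)+

lemma mirror_group_inner: "w \<in> mirror_group \<Phi> \<Longrightarrow> w x \<bullet> w y = x \<bullet> y"
  by (induction arbitrary: x y rule: mirror_group.induct) (simp_all add: mirror_inner)

lemma mirror_group_displacement: "w \<in> mirror_group \<Phi> \<Longrightarrow> w x - x \<in> span \<Phi>"
proof (induction rule: mirror_group.induct)
  case (step w \<beta>)
  have eq: "(mirror \<beta> \<circ> w) x - x = (w x - x) - (2 * (w x \<bullet> \<beta>) / (\<beta> \<bullet> \<beta>)) *\<^sub>R \<beta>"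
    by (simp add: mirror_def)
  show ?case unfolding eq by (intro span_diff span_scale step.IH span_base step.hyps)
qed (simp add: span_zero)

lemma mirror_group_comp: "w \<in> mirror_group \<Phi> \<Longrightarrow> u \<in> mirror_group \<Phi> \<Longrightarrow> w \<circ> u \<in> mirror_group \<Phi>"
  by (induction rule: mirror_group.induct) (simp_all add: comp_assoc mirror_group.step)

lemma mirror_group_right_inverse:
  "w \<in> mirror_group \<Phi> \<Longrightarrow> \<exists>u\<in>mirror_group \<Phi>. \<forall>x. w (u x) = x"
proof (induction rule: mirror_group.induct)
  case one
  show ?case by (rule bexI[OF _ mirror_group.one]) simp
next
  case (step w \<beta>)
  from step.IH obtain u where u: "u \<in> mirror_group \<Phi>" "\<forall>x. w (u x) = x" ..
  have "mirror \<beta> \<in> mirror_group \<Phi>" using mirror_group.step[OF mirror_group.one step.hyps(2)] by simp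
  from mirror_group_comp[OF u(1) this] show ?case
    by (rule bexI[rotated]) (simp add: u(2))
qed

lemma inner_span_zero:
  assumes "x \<in> span S" "\<And>b. b \<in> S \<Longrightarrow> x \<bullet> b = 0"
  shows "x = 0"
proof -
  have "x \<bullet> x = 0"
    using orthogonal_to_span[OF assms(1), of x] assms(2)
    by (auto simp: orthogonal_def)
  then show ?thesis by simp
qed

locale finite_root_set =
  fixes \<Phi> :: "'v::real_inner set"
  assumes finite_roots: "finite \<Phi>"
    and nonzero_roots: "0 \<notin> \<Phi>"
    and mirror_closed: "\<And>\<beta> \<gamma>. \<beta> \<in> \<Phi> \<Longrightarrow> \<gamma> \<in> \<Phi> \<Longrightarrow> mirror \<beta> \<gamma> \<in> \<Phi>"
begin

lemma uminus_root: "\<beta> \<in> \<Phi> \<Longrightarrow> - \<beta> \<in> \<Phi>"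
  using mirror_closed[of \<beta> \<beta>] mirror_self[of \<beta>] nonzero_roots by force

lemma mirror_group_roots: "w \<in> mirror_group \<Phi> \<Longrightarrow> w ` \<Phi> = \<Phi>"
proof -
  assume w: "w \<in> mirror_group \<Phi>"
  have "w \<beta> \<in> \<Phi>" if "\<beta> \<in> \<Phi>" for \<beta>
    using w that by (induction rule: mirror_group.induct) (auto intro: mirror_closed)
  then have sub: "w ` \<Phi> \<subseteq> \<Phi>" by auto
  have "inj w"
  proof (rule injI)
    fix x y assume "w x = w y"
    then have "w (x - y) \<bullet> w (x - y) = 0"
      using linear_mirror_group[OF w] by (simp add: linear_diff)
    then show "x = y" using mirror_group_inner[OF w] by simp
  qed
  then show ?thesis using endo_inj_surj[OF finite_roots sub] by (blast intro: inj_on_subset)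
qed

text \<open>A point of an orbit is known once its inner products with the roots are, because two points
  of an orbit differ by an element of the span of the roots; and these inner products are among
  those of the base point, because the group permutes the roots.\<close>

lemma finite_mirror_orbit: "finite ((\<lambda>w. w x) ` mirror_group \<Phi>)"
proof (rule inj_on_finite)
  let ?h = "\<lambda>y. restrict (\<lambda>\<beta>. y \<bullet> \<beta>) \<Phi>"
  show "inj_on ?h ((\<lambda>w. w x) ` mirror_group \<Phi>)"
  proof (rule inj_onI)
    fix y z assume y: "y \<in> (\<lambda>w. w x) ` mirror_group \<Phi>" and z: "z \<in> (\<lambda>w. w x) ` mirror_group \<Phi>"
      and eq: "?h y = ?h z"
    have "y - x \<in> span \<Phi>" "z - x \<in> span \<Phi>"
      using y z mirror_group_displacement by blast+
    then have "y - z \<in> span \<Phi>" using span_diff by fastforce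
    moreover have "(y - z) \<bullet> \<beta> = 0" if "\<beta> \<in> \<Phi>" for \<beta>
      using fun_cong[OF eq, of \<beta>] that by (simp add: inner_diff_left)
    ultimately show "y = z" using inner_span_zero[of "y - z" \<Phi>] by simp
  qed
  show "?h ` (\<lambda>w. w x) ` mirror_group \<Phi> \<subseteq> \<Phi> \<rightarrow>\<^sub>E (\<lambda>\<beta>. x \<bullet> \<beta>) ` \<Phi>"
  proof (rule image_subsetI, elim imageE, hypsubst)
    fix w assume w: "w \<in> mirror_group \<Phi>"
    have "w x \<bullet> \<beta> \<in> (\<lambda>\<beta>. x \<bullet> \<beta>) ` \<Phi>" if \<beta>: "\<beta> \<in> \<Phi>" for \<beta>
    proof -
      obtain \<gamma> where "\<gamma> \<in> \<Phi>" "\<beta> = w \<gamma>" using mirror_group_roots[OF w] \<beta> by (metis imageE)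
      then show ?thesis using mirror_group_inner[OF w] by simp
    qed
    then show "?h (w x) \<in> \<Phi> \<rightarrow>\<^sub>E (\<lambda>\<beta>. x \<bullet> \<beta>) ` \<Phi>" by auto
  qed
  show "finite (\<Phi> \<rightarrow>\<^sub>E (\<lambda>\<beta>. x \<bullet> \<beta>) ` \<Phi>)" by (intro finite_PiE finite_roots finite_imageI)
qed

end

text \<open>Simple roots are indexed by \<open>I\<close>. Coefficients of roots are natural numbers, so that the height of a
  root can serve as an induction measure.\<close>

locale simple_system = finite_root_set \<Phi> for \<Phi> :: "'v::real_inner set" +
  fixes \<delta> :: "nat \<Rightarrow> 'v" and I :: "nat set"
  assumes finite_I: "finite I"
    and simple_in_roots: "\<And>i. i \<in> I \<Longrightarrow> \<delta> i \<in> \<Phi>"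
    and independent_simple: "\<And>c i. (\<Sum>i\<in>I. c i *\<^sub>R \<delta> i) = 0 \<Longrightarrow> i \<in> I \<Longrightarrow> c i = 0"
    and positive_or_negative: "\<And>\<beta>. \<beta> \<in> \<Phi> \<Longrightarrow> \<exists>m :: nat \<Rightarrow> nat.
           \<beta> = (\<Sum>i\<in>I. real (m i) *\<^sub>R \<delta> i) \<or> \<beta> = - (\<Sum>i\<in>I. real (m i) *\<^sub>R \<delta> i)"
    and reduced_simple: "\<And>i k. i \<in> I \<Longrightarrow> real k *\<^sub>R \<delta> i \<in> \<Phi> \<Longrightarrow> k = 1"
begin

definition positive :: "'v \<Rightarrow> bool" where
  "positive \<beta> \<longleftrightarrow> (\<exists>m :: nat \<Rightarrow> nat. \<beta> = (\<Sum>i\<in>I. real (m i) *\<^sub>R \<delta> i))"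

definition simple_cone :: "'v set" where
  "simple_cone = {\<Sum>i\<in>I. c i *\<^sub>R \<delta> i |c. \<forall>i\<in>I. 0 \<le> c i}"

fun word :: "nat list \<Rightarrow> 'v \<Rightarrow> 'v" where
  "word [] = id"
| "word (i # ws) = mirror (\<delta> i) \<circ> word ws"

lemma word_append: "word (us @ ws) = word us \<circ> word ws"
  by (induction us) auto

lemma word_in_mirror_group: "set ws \<subseteq> I \<Longrightarrow> word ws \<in> mirror_group \<Phi>"
  by (induction ws) (auto intro: mirror_group.intros simple_in_roots)

lemma simple_nonzero: "i \<in> I \<Longrightarrow> \<delta> i \<noteq> 0"
  using simple_in_roots nonzero_roots by metis

lemma simple_inner_self: "i \<in> I \<Longrightarrow> 0 < \<delta> i \<bullet> \<delta> i"
  using simple_nonzero by simp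

lemma coefficients_unique:
  assumes "(\<Sum>i\<in>I. c i *\<^sub>R \<delta> i) = (\<Sum>i\<in>I. d i *\<^sub>R \<delta> i)" "i \<in> I"
  shows "c i = d i"
proof -
  have "(\<Sum>i\<in>I. (c i - d i) *\<^sub>R \<delta> i) = 0"
    using assms(1) by (simp add: scaleR_left_diff_distrib sum_subtractf)
  then show ?thesis using independent_simple[of "\<lambda>i. c i - d i" i] assms(2) by auto
qed

lemma subtract_simple_multiple:
  assumes "i \<in> I"
  shows "(\<Sum>j\<in>I. c j *\<^sub>R \<delta> j) - k *\<^sub>R \<delta> i = (\<Sum>j\<in>I. (if j = i then c j - k else c j) *\<^sub>R \<delta> j)"
proof -
  have "k *\<^sub>R \<delta> i = (\<Sum>j\<in>I. (if j = i then k *\<^sub>R \<delta> j else 0))"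
    using assms finite_I by simp
  then have "(\<Sum>j\<in>I. c j *\<^sub>R \<delta> j) - k *\<^sub>R \<delta> i = (\<Sum>j\<in>I. c j *\<^sub>R \<delta> j - (if j = i then k *\<^sub>R \<delta> j else 0))"
    by (simp add: sum_subtractf)
  also have "\<dots> = (\<Sum>j\<in>I. (if j = i then c j - k else c j) *\<^sub>R \<delta> j)"
    by (rule sum.cong) (auto simp: scaleR_left_diff_distrib)
  finally show ?thesis .
qed

lemma positive_cases: "\<beta> \<in> \<Phi> \<Longrightarrow> positive \<beta> \<or> positive (- \<beta>)"
  using positive_or_negative[of \<beta>] unfolding positive_def by (metis minus_minus)

lemma positive_uminus_zero:
  assumes "positive \<beta>" "positive (- \<beta>)"
  shows "\<beta> = 0"
proof -
  obtain m m' :: "nat \<Rightarrow> nat" where m: "\<beta> = (\<Sum>i\<in>I. real (m i) *\<^sub>R \<delta> i)"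
    and m': "- \<beta> = (\<Sum>i\<in>I. real (m' i) *\<^sub>R \<delta> i)"
    using assms unfolding positive_def by blast
  have "(\<Sum>i\<in>I. (real (m i) + real (m' i)) *\<^sub>R \<delta> i) = \<beta> + - \<beta>"
    unfolding m m'[unfolded m] by (simp add: scaleR_left_distrib sum.distrib)
  then have "real (m i) + real (m' i) = 0" if "i \<in> I" for i
    using independent_simple[of "\<lambda>i. real (m i) + real (m' i)"] that by auto
  then have "m i = 0" if "i \<in> I" for i using that by fastforce
  then show ?thesis unfolding m by (intro sum.neutral) auto
qed

lemma simple_as_combination: "i \<in> I \<Longrightarrow> \<delta> i = (\<Sum>j\<in>I. (if j = i then 1 else 0) *\<^sub>R \<delta> j)"
  using finite_I by (simp add: if_distrib[of "\<lambda>c. c *\<^sub>R _"] cong: if_cong)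

lemma positive_simple: "i \<in> I \<Longrightarrow> positive (\<delta> i)"
  unfolding positive_def
  by (rule exI[of _ "\<lambda>j. if j = i then 1 else 0"]) (simp add: simple_as_combination if_distrib[of real] cong: if_cong)

text \<open>A simple reflection changes only one coefficient of a positive root, so another coefficient
  keeps the image positive, unless the root is a multiple of the simple root.\<close>

lemma simple_mirror_positive:
  assumes "i \<in> I" "\<beta> \<in> \<Phi>" "positive \<beta>" "\<beta> \<noteq> \<delta> i"
  shows "positive (mirror (\<delta> i) \<beta>)"
proof (rule ccontr)
  assume neg: "\<not> positive (mirror (\<delta> i) \<beta>)"
  obtain m :: "nat \<Rightarrow> nat" where m: "\<beta> = (\<Sum>i\<in>I. real (m i) *\<^sub>R \<delta> i)"
    using assms(3) unfolding positive_def by blast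
  have "positive (- mirror (\<delta> i) \<beta>)"
    using neg positive_cases[of "mirror (\<delta> i) \<beta>"] mirror_closed assms(1,2) simple_in_roots by blast
  then obtain m' :: "nat \<Rightarrow> nat" where "- mirror (\<delta> i) \<beta> = (\<Sum>i\<in>I. real (m' i) *\<^sub>R \<delta> i)"
    unfolding positive_def by blast
  then have m': "mirror (\<delta> i) \<beta> = (\<Sum>i\<in>I. (- real (m' i)) *\<^sub>R \<delta> i)"
    by (simp add: sum_negf) (metis minus_minus)
  define k where "k = 2 * (\<beta> \<bullet> \<delta> i) / (\<delta> i \<bullet> \<delta> i)"
  have eq: "mirror (\<delta> i) \<beta> = (\<Sum>j\<in>I. (if j = i then real (m j) - k else real (m j)) *\<^sub>R \<delta> j)"
    unfolding mirror_def k_def[symmetric] using subtract_simple_multiple[OF assms(1)] m by metis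
  have zero: "m j = 0" if "j \<in> I" "j \<noteq> i" for j
    using coefficients_unique[OF eq[symmetric, unfolded m'] that(1)] that(2) by simp
  have "\<beta> = (\<Sum>j\<in>I. if j = i then real (m i) *\<^sub>R \<delta> i else 0)"
    unfolding m by (rule sum.cong) (auto simp: zero)
  then have single: "\<beta> = real (m i) *\<^sub>R \<delta> i" using assms(1) finite_I by simp
  then have "m i = 1" using reduced_simple[OF assms(1)] assms(2) by auto
  then show False using single assms(4) by simp
qed

text \<open>The exchange condition. Apply the letters of the word to \<open>\<gamma>\<close>, starting with the first one. The
  result must become negative at some letter \<open>i\<close>, and by \<open>simple_mirror_positive\<close> it was \<open>\<delta> i\<close> just
  before. So \<open>mirror \<gamma>\<close> is conjugate to \<open>mirror (\<delta> i)\<close> by the letters in front, and multiplying the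
  word by it deletes the letter \<open>i\<close>.\<close>

lemma exchange:
  assumes "set ws \<subseteq> I" "\<gamma> \<in> \<Phi>" "positive \<gamma>" "\<rho> \<in> \<Phi>" "positive \<rho>" "word ws \<rho> = - \<gamma>"
  shows "\<exists>us. set us \<subseteq> I \<and> length us < length ws \<and> mirror \<gamma> \<circ> word ws = word us"
  using assms
proof (induction ws arbitrary: \<gamma>)
  case Nil
  then have "\<gamma> = 0" by (intro positive_uminus_zero) auto
  then show ?case using Nil nonzero_roots by auto
next
  case (Cons i ws)
  then have i: "i \<in> I" by simp
  show ?case
  proof (cases "\<gamma> = \<delta> i")
    case True
    then show ?thesis using Cons.prems(1) by (intro exI[of _ ws]) (auto simp: fun_eq_iff)
  next
    case False
    let ?\<gamma> = "mirror (\<delta> i) \<gamma>"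
    have "word ws \<rho> = mirror (\<delta> i) (word (i # ws) \<rho>)" by simp
    also have "\<dots> = - ?\<gamma>"
      using Cons.prems(6) linear_mirror[of "\<delta> i"] by (simp add: linear_neg)
    finally have "word ws \<rho> = - ?\<gamma>" .
    moreover have "?\<gamma> \<in> \<Phi>" using mirror_closed simple_in_roots i Cons.prems by blast
    moreover have "positive ?\<gamma>" using simple_mirror_positive[OF i] Cons.prems False by blast
    ultimately obtain us where us: "set us \<subseteq> I" "length us < length ws"
        "mirror ?\<gamma> \<circ> word ws = word us"
      using Cons.IH[of ?\<gamma>] Cons.prems(1,4,5) by (metis set_subset_Cons subset_trans)
    have "(mirror \<gamma> \<circ> word (i # ws)) x = word (i # us) x" for x
    proof -
      have "mirror (\<delta> i) (word us x) = mirror (\<delta> i) (mirror ?\<gamma> (word ws x))"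
        unfolding us(3)[symmetric] by simp
      also have "\<dots> = mirror \<gamma> (mirror (\<delta> i) (word ws x))"
        unfolding mirror_conjugate[symmetric] by simp
      finally show ?thesis by simp
    qed
    then show ?thesis using us i by (intro exI[of _ "i # us"]) auto
  qed
qed

text \<open>A positive root has positive inner product with some simple root of its support; reflecting in
  that simple root lowers the height.\<close>

lemma positive_mirror_word:
  assumes "\<beta> \<in> \<Phi>" "\<beta> = (\<Sum>i\<in>I. real (m i) *\<^sub>R \<delta> i)"
  shows "\<exists>ws. set ws \<subseteq> I \<and> mirror \<beta> = word ws"
  using assms
proof (induction "\<Sum>i\<in>I. m i" arbitrary: \<beta> m rule: less_induct)
  case less
  note m = less.prems(2)
  have "0 < \<beta> \<bullet> \<beta>" using less.prems(1) nonzero_roots by (metis inner_gt_zero_iff)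
  also have "\<beta> \<bullet> \<beta> = (\<Sum>i\<in>I. real (m i) * (\<delta> i \<bullet> \<beta>))"
    by (subst (1) m) (simp add: inner_sum_left)
  finally obtain i where i: "i \<in> I" "0 < real (m i) * (\<delta> i \<bullet> \<beta>)"
    by (meson not_less sum_nonpos)
  then have pos: "0 < \<delta> i \<bullet> \<beta>" by (simp add: zero_less_mult_iff)
  show ?case
  proof (cases "\<beta> = \<delta> i")
    case True
    then show ?thesis using i by (intro exI[of _ "[i]"]) auto
  next
    case False
    let ?\<beta> = "mirror (\<delta> i) \<beta>"
    have root: "?\<beta> \<in> \<Phi>" using mirror_closed simple_in_roots i less.prems by blast
    have "positive ?\<beta>"
      using simple_mirror_positive[OF i(1) less.prems(1) _ False] m unfolding positive_def by blast
    then obtain m' :: "nat \<Rightarrow> nat" where m': "?\<beta> = (\<Sum>i\<in>I. real (m' i) *\<^sub>R \<delta> i)"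
      unfolding positive_def by blast
    define k where "k = 2 * (\<beta> \<bullet> \<delta> i) / (\<delta> i \<bullet> \<delta> i)"
    have k: "0 < k" using pos simple_nonzero[OF i(1)] by (simp add: k_def inner_commute)
    have eq: "?\<beta> = (\<Sum>j\<in>I. (if j = i then real (m j) - k else real (m j)) *\<^sub>R \<delta> j)"
      unfolding mirror_def k_def[symmetric] using subtract_simple_multiple[OF i(1)] m by metis
    have coeff: "real (m' j) = (if j = i then real (m j) - k else real (m j))" if "j \<in> I" for j
      using coefficients_unique[OF m'[symmetric, unfolded eq] that] by simp
    have le: "m' j \<le> m j" if "j \<in> I" for j
      using coeff[OF that] k by (auto split: if_splits)
    have "m' i < m i" using coeff[OF i(1)] k by simp
    then have "(\<Sum>i\<in>I. m' i) < (\<Sum>i\<in>I. m i)"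
      using le i(1) finite_I by (intro sum_strict_mono_ex1) auto
    then obtain ws where ws: "set ws \<subseteq> I" "mirror ?\<beta> = word ws"
      using less.hyps[OF _ root m'] by blast
    have "mirror \<beta> x = word (i # ws @ [i]) x" for x
      using mirror_conjugate[of "\<delta> i" ?\<beta> x] by (simp add: word_append ws(2))
    then show ?thesis using ws i by (intro exI[of _ "i # ws @ [i]"]) auto
  qed
qed

lemma mirror_group_word:
  assumes "w \<in> mirror_group \<Phi>"
  shows "\<exists>ws. set ws \<subseteq> I \<and> w = word ws"
  using assms
proof (induction rule: mirror_group.induct)
  case one
  then show ?case by (intro exI[of _ "[]"]) auto
next
  case (step w \<beta>)
  then obtain ws where ws: "set ws \<subseteq> I" "w = word ws" by blast
  have "\<exists>us. set us \<subseteq> I \<and> mirror \<beta> = word us"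
  proof (cases "positive \<beta>")
    case True
    then show ?thesis using positive_mirror_word step.hyps unfolding positive_def by blast
  next
    case False
    then have "positive (- \<beta>)" using positive_cases step.hyps by blast
    then show ?thesis
      using positive_mirror_word[of "- \<beta>"] uminus_root step.hyps
      unfolding positive_def mirror_uminus_left by blast
  qed
  then obtain us where "set us \<subseteq> I" "mirror \<beta> = word us" by blast
  then show ?case using ws by (intro exI[of _ "us @ ws"]) (auto simp: word_append)
qed

lemma simple_cone_add:
  assumes "i \<in> I" "0 \<le> k" "u \<in> simple_cone"
  shows "u + k *\<^sub>R \<delta> i \<in> simple_cone"
proof -
  obtain c where c: "u = (\<Sum>i\<in>I. c i *\<^sub>R \<delta> i)" "\<forall>i\<in>I. 0 \<le> c i"
    using assms(3) unfolding simple_cone_def by blast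
  have "u + k *\<^sub>R \<delta> i = (\<Sum>j\<in>I. (if j = i then c j - - k else c j) *\<^sub>R \<delta> j)"
    using subtract_simple_multiple[OF assms(1), of c "- k"] c(1) by simp
  then show ?thesis unfolding simple_cone_def using c(2) assms(2)
    by (intro CollectI exI[of _ "\<lambda>j. if j = i then c j - - k else c j"] conjI) auto
qed

text \<open>A letter \<open>i\<close> in front of a word \<open>w\<close> subtracts a multiple of \<open>\<delta> i\<close> from \<open>w u\<close>. The multiple is
  nonnegative if \<open>\<delta> i\<close> is the image under \<open>w\<close> of a positive root, by dominance of \<open>u\<close>. Otherwise the
  exchange condition replaces the word by a shorter one.\<close>

lemma dominant_word_le:
  assumes "\<And>i. i \<in> I \<Longrightarrow> 0 \<le> \<delta> i \<bullet> u" "set ws \<subseteq> I"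
  shows "u - word ws u \<in> simple_cone"
  using assms(2)
proof (induction "length ws" arbitrary: ws rule: less_induct)
  case less
  show ?case
  proof (cases ws)
    case Nil
    then show ?thesis by (auto simp: simple_cone_def intro!: exI[of _ "\<lambda>_. 0"])
  next
    case (Cons i vs)
    have i: "i \<in> I" and vs: "set vs \<subseteq> I" using less.prems Cons by auto
    note w = word_in_mirror_group[OF vs]
    obtain \<rho> where \<rho>: "\<rho> \<in> \<Phi>" "word vs \<rho> = \<delta> i"
      using mirror_group_roots[OF w] simple_in_roots[OF i] by (metis imageE)
    show ?thesis
    proof (cases "positive \<rho>")
      case True
      then obtain m :: "nat \<Rightarrow> nat" where "\<rho> = (\<Sum>i\<in>I. real (m i) *\<^sub>R \<delta> i)"
        unfolding positive_def by blast
      then have "0 \<le> \<rho> \<bullet> u" using assms(1) by (simp add: inner_sum_left sum_nonneg)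
      also have "\<rho> \<bullet> u = word vs u \<bullet> \<delta> i"
        using mirror_group_inner[OF w, of \<rho> u] \<rho>(2) by (simp add: inner_commute)
      finally have "0 \<le> 2 * (word vs u \<bullet> \<delta> i) / (\<delta> i \<bullet> \<delta> i)" by simp
      moreover have "u - word vs u \<in> simple_cone" using less.hyps[of vs] vs Cons by simp
      ultimately have "(u - word vs u) + (2 * (word vs u \<bullet> \<delta> i) / (\<delta> i \<bullet> \<delta> i)) *\<^sub>R \<delta> i \<in> simple_cone"
        using simple_cone_add[OF i] by blast
      then show ?thesis using Cons by (simp add: mirror_def algebra_simps)
    next
      case False
      then have "positive (- \<rho>)" "- \<rho> \<in> \<Phi>" using positive_cases uminus_root \<rho>(1) by blast+
      moreover have "word vs (- \<rho>) = - \<delta> i"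
        using \<rho>(2) linear_mirror_group[OF w] by (simp add: linear_neg)
      ultimately obtain us where "set us \<subseteq> I" "length us < length vs"
          "mirror (\<delta> i) \<circ> word vs = word us"
        using exchange[OF vs simple_in_roots[OF i] positive_simple[OF i]] by blast
      then show ?thesis using less.hyps[of us] Cons by simp
    qed
  qed
qed

lemma dominant_mirror_group_le:
  assumes "w \<in> mirror_group \<Phi>" "\<And>i. i \<in> I \<Longrightarrow> 0 \<le> \<delta> i \<bullet> u"
  shows "u - w u \<in> simple_cone"
  using mirror_group_word[OF assms(1)] dominant_word_le[OF assms(2)] by blast

lemma dominant_orbit_inner_le:
  assumes "w \<in> mirror_group \<Phi>" "\<And>i. i \<in> I \<Longrightarrow> 0 \<le> \<delta> i \<bullet> u" "\<And>i. i \<in> I \<Longrightarrow> 0 \<le> \<delta> i \<bullet> x"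
  shows "w u \<bullet> x \<le> u \<bullet> x"
proof -
  obtain c where c: "u - w u = (\<Sum>i\<in>I. c i *\<^sub>R \<delta> i)" "\<forall>i\<in>I. 0 \<le> c i"
    using dominant_mirror_group_le[OF assms(1,2)] unfolding simple_cone_def by blast
  have "0 \<le> (u - w u) \<bullet> x" unfolding c(1) using c(2) assms(3) by (simp add: inner_sum_left sum_nonneg)
  then show ?thesis by (simp add: inner_diff_left)
qed

text \<open>If the coefficient of \<open>\<delta> i\<close> in \<open>u - w u\<close> were zero, then \<open>u\<close> would be orthogonal to
  \<open>u - w u\<close>, which is impossible for two distinct vectors \<open>u\<close> and \<open>w u\<close> of the same length.\<close>

lemma fundamental_orbit_inner_less:
  assumes "w \<in> mirror_group \<Phi>" "\<And>j. j \<in> I \<Longrightarrow> 0 \<le> \<delta> j \<bullet> u" "\<And>j. j \<in> I \<Longrightarrow> j \<noteq> i \<Longrightarrow> \<delta> j \<bullet> u = 0"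
    and "\<And>j. j \<in> I \<Longrightarrow> 0 \<le> \<delta> j \<bullet> x" "i \<in> I" "0 < \<delta> i \<bullet> x" "w u \<noteq> u"
  shows "w u \<bullet> x < u \<bullet> x"
proof -
  obtain c where c: "u - w u = (\<Sum>i\<in>I. c i *\<^sub>R \<delta> i)" "\<forall>i\<in>I. 0 \<le> c i"
    using dominant_mirror_group_le[OF assms(1,2)] unfolding simple_cone_def by blast
  have "c i \<noteq> 0"
  proof
    assume "c i = 0"
    then have orth: "(u - w u) \<bullet> u = 0"
      unfolding c(1) inner_sum_left using assms(3) by (intro sum.neutral) auto
    have "(u - w u) \<bullet> (u - w u) = 2 * ((u - w u) \<bullet> u)"
      using mirror_group_inner[OF assms(1), of u u] by (simp add: algebra_simps inner_commute)
    then show False using orth assms(7) by simp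
  qed
  then have "0 < c i * (\<delta> i \<bullet> x)" using c(2) assms(5,6) by (simp add: order_less_le)
  then have "0 < (\<Sum>j\<in>I. c j * (\<delta> j \<bullet> x))"
    using c(2) assms(4,5) finite_I by (intro sum_pos2[of I i]) auto
  then have "0 < (u - w u) \<bullet> x" unfolding c(1) by (simp add: inner_sum_left)
  then show ?thesis by (simp add: inner_diff_left)
qed

text \<open>In \<open>mirror (\<delta> i) (\<delta> j)\<close> the coefficient of \<open>\<delta> j\<close> is \<open>1\<close>, so this root is positive and its
  coefficient at \<open>\<delta> i\<close>, which is \<open>- 2 (\<delta> j \<bullet> \<delta> i) / (\<delta> i \<bullet> \<delta> i)\<close>, cannot be negative.\<close>

lemma simple_obtuse:
  assumes "i \<in> I" "j \<in> I" "i \<noteq> j"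
  shows "\<delta> i \<bullet> \<delta> j \<le> 0"
proof -
  define k where "k = 2 * (\<delta> j \<bullet> \<delta> i) / (\<delta> i \<bullet> \<delta> i)"
  have "positive (mirror (\<delta> i) (\<delta> j))"
  proof (rule simple_mirror_positive)
    show "\<delta> j \<noteq> \<delta> i"
    proof
      assume "\<delta> j = \<delta> i"
      then have "(\<Sum>r\<in>I. (if r = i then 1 else 0) *\<^sub>R \<delta> r) = (\<Sum>r\<in>I. (if r = j then 1 else 0) *\<^sub>R \<delta> r)"
        using assms simple_as_combination by metis
      then show False using coefficients_unique[OF _ assms(1), of "\<lambda>r. if r = i then 1 else 0" "\<lambda>r. if r = j then 1 else 0"] assms(3) by simp
    qed
  qed (use assms simple_in_roots positive_simple in auto)
  then obtain m :: "nat \<Rightarrow> nat" where m: "mirror (\<delta> i) (\<delta> j) = (\<Sum>r\<in>I. real (m r) *\<^sub>R \<delta> r)"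
    unfolding positive_def by blast
  have "\<delta> j = (\<Sum>r\<in>I. (if r = j then 1 else 0) *\<^sub>R \<delta> r)"
    using assms simple_as_combination by blast
  then have "mirror (\<delta> i) (\<delta> j)
      = (\<Sum>r\<in>I. (if r = i then (if r = j then 1 else 0) - k else (if r = j then 1 else 0)) *\<^sub>R \<delta> r)"
    unfolding mirror_def k_def[symmetric] using subtract_simple_multiple[OF assms(1)] by metis
  from coefficients_unique[OF m[symmetric, unfolded this] assms(1)]
  have "k \<le> 0" using assms(3) by simp
  then show ?thesis
    using simple_inner_self[OF assms(1)]
    by (simp add: k_def inner_commute divide_le_0_iff not_le[symmetric] del: inner_gt_zero_iff)
qed

text \<open>Split \<open>y\<close> into the parts with nonnegative and negative coefficients. The negative part has
  nonpositive inner product with the other one, because simple roots form obtuse angles.\<close>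

lemma dominant_coefficients_nonneg:
  assumes y: "y = (\<Sum>i\<in>I. c i *\<^sub>R \<delta> i)" and dom: "\<And>i. i \<in> I \<Longrightarrow> 0 \<le> \<delta> i \<bullet> y" and "i \<in> I"
  shows "0 \<le> c i"
proof -
  define p q where "p = (\<Sum>i\<in>I. max (c i) 0 *\<^sub>R \<delta> i)" and "q = (\<Sum>i\<in>I. max (- c i) 0 *\<^sub>R \<delta> i)"
  have "p - q = (\<Sum>i\<in>I. (max (c i) 0 - max (- c i) 0) *\<^sub>R \<delta> i)"
    unfolding p_def q_def by (simp add: scaleR_left_diff_distrib sum_subtractf)
  also have "\<dots> = y" unfolding y by (rule sum.cong) (auto simp: max_def)
  finally have pq: "p - q = y" .
  have "q \<bullet> p = (\<Sum>i\<in>I. \<Sum>j\<in>I. (max (- c i) 0 * max (c j) 0) * (\<delta> i \<bullet> \<delta> j))"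
    unfolding q_def inner_sum_left
    by (rule sum.cong) (simp_all add: p_def inner_sum_right sum_distrib_left mult_ac)
  also have "\<dots> \<le> 0"
  proof (intro sum_nonpos)
    fix i j assume "i \<in> I" "j \<in> I"
    then show "(max (- c i) 0 * max (c j) 0) * (\<delta> i \<bullet> \<delta> j) \<le> 0"
      using simple_obtuse[of i j] by (cases "i = j") (auto simp: max_def mult_nonneg_nonpos)
  qed
  finally have "q \<bullet> p \<le> 0" .
  moreover have "0 \<le> q \<bullet> y"
    unfolding q_def inner_sum_left using dom by (intro sum_nonneg) auto
  ultimately have "q \<bullet> q \<le> 0" unfolding pq[symmetric] by (simp add: inner_diff_right)
  then have "q \<bullet> q = 0" using inner_ge_zero[of q] by linarith
  then have "q = 0" by simp
  then have "max (- c i) 0 = 0" 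
    using independent_simple[of "\<lambda>i. max (- c i) 0" i] assms(3) by (simp add: q_def)
  then show ?thesis by (simp add: max_def split: if_splits)
qed

text \<open>A point of the orbit that maximizes the pairing with a vector in the interior of the dominant
  chamber is dominant, because a simple reflection cannot increase the pairing.\<close>

lemma dominant_in_mirror_orbit:
  assumes "\<And>i. i \<in> I \<Longrightarrow> 0 < \<delta> i \<bullet> f"
  shows "\<exists>w\<in>mirror_group \<Phi>. \<forall>i\<in>I. 0 \<le> \<delta> i \<bullet> w x"
proof -
  let ?O = "(\<lambda>w. w x) ` mirror_group \<Phi>"
  let ?M = "Max ((\<lambda>y. y \<bullet> f) ` ?O)"
  have fin: "finite ((\<lambda>y. y \<bullet> f) ` ?O)" using finite_mirror_orbit by (rule finite_imageI)
  have "(\<lambda>y. y \<bullet> f) ` ?O \<noteq> {}" using mirror_group.one by blast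
  then have "?M \<in> (\<lambda>y. y \<bullet> f) ` ?O" by (rule Max_in[OF fin])
  then obtain y where y0: "y \<in> ?O" "?M = y \<bullet> f" by blast
  have y: "z \<bullet> f \<le> y \<bullet> f" if "z \<in> ?O" for z
    unfolding y0(2)[symmetric] using that by (intro Max_ge[OF fin]) blast
  then obtain w where w: "w \<in> mirror_group \<Phi>" "y = w x" using y0 by blast
  have "0 \<le> \<delta> i \<bullet> y" if i: "i \<in> I" for i
  proof -
    have "mirror (\<delta> i) y \<in> ?O"
      using mirror_group.step[OF w(1) simple_in_roots[OF i]] unfolding w(2) by (metis comp_apply image_eqI)
    then have "(mirror (\<delta> i) y) \<bullet> f \<le> y \<bullet> f" using y by blast
    then have "0 \<le> 2 * (y \<bullet> \<delta> i) / (\<delta> i \<bullet> \<delta> i) * (\<delta> i \<bullet> f)"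
      by (simp add: mirror_def inner_diff_left)
    then show ?thesis using assms[OF i] simple_inner_self[OF i]
      by (simp add: zero_le_mult_iff zero_le_divide_iff inner_commute not_le[symmetric] del: inner_gt_zero_iff)
  qed
  then show ?thesis using w by blast
qed

end

section \<open>The retraction onto the dominant chamber and its extension\<close>

lemma tendsto_fun_coordinatewise:
  fixes s :: "nat \<Rightarrow> 'a \<Rightarrow> 'b::topological_space"
  assumes "\<And>i. (\<lambda>k. s k i) \<longlonglongrightarrow> d i"
  shows "s \<longlonglongrightarrow> d"
  using assms limitin_componentwise[of "\<lambda>_. euclidean :: 'b topology" UNIV s d sequentially]
  by (simp add: euclidean_product_topology)

lemma extended_spaceD:
  assumes "d \<in> extended_space l n"
  shows "i \<in> {1..l} \<Longrightarrow> d i \<noteq> \<infinity>" "i \<in> {l+1..n} \<Longrightarrow> \<bar>d i\<bar> \<noteq> \<infinity>" "i \<notin> {1..n} \<Longrightarrow> d i = 0"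
  using assms unfolding extended_space_def mem_Collect_eq by metis+

text \<open>The vectors \<open>e i\<close> form a basis and the vectors \<open>f i\<close> the dual one; the first \<open>l\<close>
  vectors \<open>e i\<close> are the inner normals of the chamber. The last assumption says that a chamber
  point with vanishing central coordinates is a nonnegative combination of the normals.\<close>

locale dual_frame =
  fixes rp :: "'x \<Rightarrow> 'v::{real_inner, heine_borel} \<Rightarrow> real" and \<alpha> \<omega> :: "nat \<Rightarrow> 'x" and l n :: nat
    and e f :: "nat \<Rightarrow> 'v"
  assumes l_le_n: "l \<le> n"
    and rp_weight: "\<And>i x. i \<in> {1..n} \<Longrightarrow> rp (\<omega> i) x = f i \<bullet> x"
    and in_dominant_iff: "\<And>x. x \<in> dominant rp \<alpha> l \<longleftrightarrow> (\<forall>i\<in>{1..l}. 0 \<le> e i \<bullet> x)"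
    and dual: "\<And>i j. i \<in> {1..n} \<Longrightarrow> j \<in> {1..n} \<Longrightarrow> f i \<bullet> e j = (if i = j then 1 else 0)"
    and expansion: "\<And>x. (\<Sum>i\<in>{1..n}. (f i \<bullet> x) *\<^sub>R e i) = x"
    and dominant_weight_nonneg: "\<And>x i. (\<And>j. j \<in> {l+1..n} \<Longrightarrow> f j \<bullet> x = 0) \<Longrightarrow>
          (\<And>j. j \<in> {1..l} \<Longrightarrow> 0 \<le> e j \<bullet> x) \<Longrightarrow> i \<in> {1..l} \<Longrightarrow> 0 \<le> f i \<bullet> x"
begin

lemma index_cases: "i \<in> {1..n} \<longleftrightarrow> i \<in> {1..l} \<or> i \<in> {l+1..n}"
  using l_le_n by auto

lemma f_sum:
  assumes "i \<in> {1..n}"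
  shows "f i \<bullet> (\<Sum>j\<in>{1..n}. c j *\<^sub>R e j) = c i"
proof -
  have "f i \<bullet> (\<Sum>j\<in>{1..n}. c j *\<^sub>R e j) = (\<Sum>j\<in>{1..n}. if i = j then c j else 0)"
    unfolding inner_sum_right by (rule sum.cong) (use assms dual in auto)
  also have "\<dots> = c i" using assms by simp
  finally show ?thesis .
qed

lemma inner_expansion: "x \<bullet> y = (\<Sum>i\<in>{1..n}. (f i \<bullet> x) * (e i \<bullet> y))"
proof -
  have "x \<bullet> y = (\<Sum>i\<in>{1..n}. (f i \<bullet> x) *\<^sub>R e i) \<bullet> y" by (simp only: expansion)
  then show ?thesis by (simp add: inner_sum_left)
qed

lemma convex_dominant: "convex (dominant rp \<alpha> l)"
  by (rule convexI) (simp add: in_dominant_iff inner_add_right)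

lemma closed_dominant: "closed (dominant rp \<alpha> l)"
proof -
  have "dominant rp \<alpha> l = (\<Inter>i\<in>{1..l}. {x. 0 \<le> e i \<bullet> x})"
    using in_dominant_iff by blast
  then show ?thesis by (simp add: closed_INT closed_Collect_le continuous_on_inner)
qed

lemma zero_dominant: "0 \<in> dominant rp \<alpha> l"
  by (simp add: in_dominant_iff)

lemma dominant_nonempty: "dominant rp \<alpha> l \<noteq> {}"
  using zero_dominant by blast

lemma retraction_dominant: "retraction_dom rp \<alpha> l x \<in> dominant rp \<alpha> l"
  unfolding retraction_dom_def
  by (rule closest_point_in_set[OF closed_dominant dominant_nonempty])

text \<open>The displacement \<open>u - x\<close> is a nonpositive combination of the normals of walls that contain \<open>x\<close>, so
  it makes a nonacute angle with \<open>y - x\<close> for every \<open>y\<close> in the chamber.\<close>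

lemma retraction_eqI:
  assumes x: "x \<in> dominant rp \<alpha> l"
    and central: "\<And>i. i \<in> {l+1..n} \<Longrightarrow> f i \<bullet> u = f i \<bullet> x"
    and le: "\<And>i. i \<in> {1..l} \<Longrightarrow> f i \<bullet> u \<le> f i \<bullet> x"
    and slack: "\<And>i. i \<in> {1..l} \<Longrightarrow> 0 < e i \<bullet> x \<Longrightarrow> f i \<bullet> u = f i \<bullet> x"
  shows "retraction_dom rp \<alpha> l u = x"
proof -
  have "dist u x \<le> dist u y" if y: "y \<in> dominant rp \<alpha> l" for y
  proof -
    have "(f i \<bullet> (u - x)) * (e i \<bullet> (y - x)) \<le> 0" if i: "i \<in> {1..n}" for i
    proof (cases "i \<in> {1..l} \<and> e i \<bullet> x = 0")
      case True
      then show ?thesis using le[of i] y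
        by (auto simp: inner_diff_right in_dominant_iff intro!: mult_nonpos_nonneg)
    next
      case False
      then have "f i \<bullet> u = f i \<bullet> x"
        using i central[of i] slack[of i] x index_cases unfolding in_dominant_iff by force
      then show ?thesis by (simp add: inner_diff_right)
    qed
    then have "(u - x) \<bullet> (y - x) \<le> 0" unfolding inner_expansion[of "u - x"] by (rule sum_nonpos)
    then have "(u - x) \<bullet> (u - x) \<le> (u - y) \<bullet> (u - y)"
      using inner_ge_zero[of "y - x"] by (simp add: algebra_simps inner_commute)
    then show ?thesis by (simp add: dist_norm norm_le)
  qed
  then show ?thesis unfolding retraction_dom_def
    using closest_point_unique[OF convex_dominant closed_dominant x] by auto
qed

text \<open>The optimality inequality of the closest point \<open>x\<close>, tested in the directions of the dual
  vectors \<open>f i\<close> and of \<open>x\<close> itself, says that \<open>x - u\<close> is a nonnegative combination of the normals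
  of the walls that contain \<open>x\<close>.\<close>

lemma retraction_optimality:
  fixes u
  defines "x \<equiv> retraction_dom rp \<alpha> l u"
  shows "i \<in> {l+1..n} \<Longrightarrow> f i \<bullet> u = f i \<bullet> x"
    and "i \<in> {1..l} \<Longrightarrow> f i \<bullet> u \<le> f i \<bullet> x"
    and "i \<in> {1..l} \<Longrightarrow> 0 < e i \<bullet> x \<Longrightarrow> f i \<bullet> u = f i \<bullet> x"
proof -
  have x: "x \<in> dominant rp \<alpha> l" unfolding x_def by (rule retraction_dominant)
  have opt: "(u - x) \<bullet> (y - x) \<le> 0" if "y \<in> dominant rp \<alpha> l" for y
    using closest_point_dot[OF convex_dominant closed_dominant that]
    unfolding x_def retraction_dom_def .
  have ef: "e j \<bullet> f i = (if i = j then 1 else 0)" if "i \<in> {1..n}" "j \<in> {1..l}" for i j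
    using dual[of i j] that l_le_n by (simp add: inner_commute)
  have central: "f i \<bullet> u = f i \<bullet> x" if i: "i \<in> {l+1..n}" for i
  proof -
    have "x + s *\<^sub>R f i \<in> dominant rp \<alpha> l" for s
      using x i l_le_n ef[of i] by (auto simp: in_dominant_iff inner_add_right)
    \<comment> \<open>Central directions may be followed both ways within the chamber.\<close>
    from opt[OF this[of 1]] opt[OF this[of "- 1"]] show ?thesis
      by (simp add: inner_diff_left inner_diff_right inner_commute)
  qed
  have le: "f i \<bullet> u \<le> f i \<bullet> x" if i: "i \<in> {1..l}" for i
  proof -
    have "x + f i \<in> dominant rp \<alpha> l"
      using x i l_le_n ef[of i] by (auto simp: in_dominant_iff inner_add_right)
    from opt[OF this] show ?thesis by (simp add: inner_diff_left inner_diff_right inner_commute)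
  qed
  \<comment> \<open>Testing with \<open>2 x\<close> and \<open>0\<close> gives \<open>(u - x) \<bullet> x = 0\<close>, a vanishing sum of terms of one sign.\<close>
  have "x + x \<in> dominant rp \<alpha> l" using x by (auto simp: in_dominant_iff inner_add_right)
  from opt[OF this] opt[OF zero_dominant] have "(u - x) \<bullet> x = 0" by simp
  then have sum0: "(\<Sum>j\<in>{1..n}. - ((f j \<bullet> (u - x)) * (e j \<bullet> x))) = 0"
    unfolding inner_expansion[of "u - x"] by (simp add: sum_negf)
  have nonneg: "0 \<le> - ((f j \<bullet> (u - x)) * (e j \<bullet> x))" if j: "j \<in> {1..n}" for j
  proof (cases "j \<in> {1..l}")
    case True
    then show ?thesis using le[of j] x
      by (auto simp: in_dominant_iff inner_diff_right intro!: mult_nonpos_nonneg)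
  next
    case False
    then show ?thesis using central[of j] j by (auto simp: inner_diff_right)
  qed
  have slack: "f i \<bullet> u = f i \<bullet> x" if i: "i \<in> {1..l}" "0 < e i \<bullet> x" for i
  proof -
    have "- ((f i \<bullet> (u - x)) * (e i \<bullet> x)) = 0"
      using sum_nonneg_0[OF finite_atLeastAtMost nonneg sum0, of i] i l_le_n by auto
    then show ?thesis using i by (simp add: inner_diff_right)
  qed
  show "i \<in> {l+1..n} \<Longrightarrow> f i \<bullet> u = f i \<bullet> x" by (rule central)
  show "i \<in> {1..l} \<Longrightarrow> f i \<bullet> u \<le> f i \<bullet> x" by (rule le)
  show "i \<in> {1..l} \<Longrightarrow> 0 < e i \<bullet> x \<Longrightarrow> f i \<bullet> u = f i \<bullet> x" by (rule slack)
qed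

text \<open>The component of \<open>e j\<close> orthogonal to the normals of all walls.\<close>

definition central_basis :: "nat \<Rightarrow> 'v" where
  "central_basis j = (SOME p. e j - p \<in> span (e ` {1..l}) \<and> (\<forall>b\<in>span (e ` {1..l}). p \<bullet> b = 0))"

lemma central_basis:
  "e j - central_basis j \<in> span (e ` {1..l})"
  "i \<in> {1..l} \<Longrightarrow> e i \<bullet> central_basis j = 0"
proof -
  have "\<exists>p. e j - p \<in> span (e ` {1..l}) \<and> (\<forall>b\<in>span (e ` {1..l}). p \<bullet> b = 0)"
  proof -
    have "finite (e ` {1..l})" by simp
    from orthogonal_projection_off_span[OF this, of "e j"] show ?thesis by metis
  qed
  from someI_ex[OF this, folded central_basis_def]
  have p: "e j - central_basis j \<in> span (e ` {1..l})"
    and orth: "\<forall>b\<in>span (e ` {1..l}). central_basis j \<bullet> b = 0"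
    by blast+
  show "e j - central_basis j \<in> span (e ` {1..l})" by (rule p)
  show "e i \<bullet> central_basis j = 0" if "i \<in> {1..l}"
    using bspec[OF orth span_base[OF imageI[OF that]]] by (simp only: inner_commute)
qed

text \<open>The point of the central subspace (the intersection of all walls) with the central coordinates of \<open>d\<close>.\<close>

definition central_part :: "(nat \<Rightarrow> ereal) \<Rightarrow> 'v" where
  "central_part d = (\<Sum>j\<in>{l+1..n}. real_of_ereal (d j) *\<^sub>R central_basis j)"

text \<open>Replacing the coordinate \<open>d i\<close>, which may be \<open>-\<infinity>\<close>, by its maximum with the finite number
  \<open>f i \<bullet> central_part d\<close> does not affect the retraction, as a chamber point with
  the central coordinates of \<open>d\<close> has an \<open>i\<close>-th coordinate of at least that size.\<close>

definition truncation :: "(nat \<Rightarrow> ereal) \<Rightarrow> 'v" where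
  "truncation d = (\<Sum>i\<in>{1..n}. (if i \<in> {1..l}
     then real_of_ereal (max (d i) (ereal (f i \<bullet> central_part d))) else real_of_ereal (d i)) *\<^sub>R e i)"

lemma f_truncation:
  "i \<in> {1..l} \<Longrightarrow> f i \<bullet> truncation d = real_of_ereal (max (d i) (ereal (f i \<bullet> central_part d)))"
  "i \<in> {l+1..n} \<Longrightarrow> f i \<bullet> truncation d = real_of_ereal (d i)"
proof -
  show "f i \<bullet> truncation d = real_of_ereal (max (d i) (ereal (f i \<bullet> central_part d)))"
    if "i \<in> {1..l}"
    using f_sum[of i] that index_cases[of i] unfolding truncation_def by presburger
  show "f i \<bullet> truncation d = real_of_ereal (d i)" if "i \<in> {l+1..n}"
  proof -
    have "i \<notin> {1..l}" using that by simp
    then show ?thesis using f_sum[of i] that index_cases[of i] unfolding truncation_def by presburger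
  qed
qed

text \<open>Subtracting the central part from \<open>x\<close> leaves a point of the chamber whose central coordinates
  vanish, and the remaining coordinates of such a point are nonnegative.\<close>

lemma central_part_le:
  assumes x: "x \<in> dominant rp \<alpha> l" and d: "\<And>j. j \<in> {l+1..n} \<Longrightarrow> d j = ereal (f j \<bullet> x)"
    and i: "i \<in> {1..l}"
  shows "f i \<bullet> central_part d \<le> f i \<bullet> x"
proof -
  define y where "y = x - central_part d"
  have split: "{1..n} = {1..l} \<union> {l+1..n}" "{1..l} \<inter> {l+1..n} = {}" using l_le_n by auto
  have "x = (\<Sum>j\<in>{1..l}. (f j \<bullet> x) *\<^sub>R e j) + (\<Sum>j\<in>{l+1..n}. (f j \<bullet> x) *\<^sub>R e j)"
    using expansion[of x] unfolding split(1) by (subst (asm) sum.union_disjoint) (auto simp: split)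
  then have "y = (\<Sum>j\<in>{1..l}. (f j \<bullet> x) *\<^sub>R e j)
      + (\<Sum>j\<in>{l+1..n}. (f j \<bullet> x) *\<^sub>R (e j - central_basis j))"
    unfolding y_def central_part_def using d by (simp add: scaleR_right_diff_distrib sum_subtractf)
  also have "\<dots> \<in> span (e ` {1..l})"
    by (intro span_add span_sum span_scale central_basis(1) span_base imageI)
  finally have y_span: "y \<in> span (e ` {1..l})" .
  have "f j \<bullet> y = 0" if "j \<in> {l+1..n}" for j
  proof -
    have "orthogonal (f j) y"
      by (rule orthogonal_to_span[OF y_span]) (use that dual[of j] l_le_n in \<open>auto simp: orthogonal_def\<close>)
    then show ?thesis by (simp add: orthogonal_def)
  qed
  moreover have "0 \<le> e j \<bullet> y" if "j \<in> {1..l}" for j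
    using x that central_basis(2)[of j] unfolding y_def central_part_def
    by (simp add: inner_diff_right inner_sum_right in_dominant_iff)
  ultimately have "0 \<le> f i \<bullet> y" using dominant_weight_nonneg[of y i] i by blast
  then show ?thesis unfolding y_def by (simp add: inner_diff_right)
qed

text \<open>Truncation raises coordinates of \<open>d\<close> but keeps them below those of \<open>x\<close>, so the
  conditions of \<open>retraction_eqI\<close> pass from \<open>d\<close> to its truncation.\<close>

lemma retraction_truncation_eqI:
  assumes x: "x \<in> dominant rp \<alpha> l"
    and central: "\<And>i. i \<in> {l+1..n} \<Longrightarrow> d i = ereal (f i \<bullet> x)"
    and le: "\<And>i. i \<in> {1..l} \<Longrightarrow> d i \<le> ereal (f i \<bullet> x)"
    and slack: "\<And>i. i \<in> {1..l} \<Longrightarrow> 0 < e i \<bullet> x \<Longrightarrow> d i = ereal (f i \<bullet> x)"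
  shows "retraction_dom rp \<alpha> l (truncation d) = x"
proof (rule retraction_eqI[OF x])
  fix i assume i: "i \<in> {1..l}"
  have low: "f i \<bullet> central_part d \<le> f i \<bullet> x" by (rule central_part_le[OF x _ i]) (rule central)
  have "max (d i) (ereal (f i \<bullet> central_part d)) \<le> ereal (f i \<bullet> x)" using le[OF i] low by simp
  moreover have "ereal (f i \<bullet> central_part d) \<le> max (d i) (ereal (f i \<bullet> central_part d))" by simp
  ultimately show "f i \<bullet> truncation d \<le> f i \<bullet> x"
    unfolding f_truncation(1)[OF i] by (cases "max (d i) (ereal (f i \<bullet> central_part d))") auto
  show "f i \<bullet> truncation d = f i \<bullet> x" if "0 < e i \<bullet> x"
    unfolding f_truncation(1)[OF i] slack[OF i that] using low by (simp add: max_def)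
qed (simp add: f_truncation central)

lemma retraction_truncation_coords:
  "retraction_dom rp \<alpha> l (truncation (coords rp \<omega> n x)) = retraction_dom rp \<alpha> l x"
proof (rule retraction_truncation_eqI[OF retraction_dominant])
  show "coords rp \<omega> n x i = ereal (f i \<bullet> retraction_dom rp \<alpha> l x)" if "i \<in> {l+1..n}" for i
    using that retraction_optimality(1)[OF that, of x] by (simp add: coords_def rp_weight)
  show "coords rp \<omega> n x i \<le> ereal (f i \<bullet> retraction_dom rp \<alpha> l x)" if "i \<in> {1..l}" for i
    using that l_le_n retraction_optimality(2)[OF that, of x] by (simp add: coords_def rp_weight)
  show "coords rp \<omega> n x i = ereal (f i \<bullet> retraction_dom rp \<alpha> l x)"
    if "i \<in> {1..l}" "0 < e i \<bullet> retraction_dom rp \<alpha> l x" for i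
    using that l_le_n retraction_optimality(3)[OF that] by (simp add: coords_def rp_weight)
qed

lemma continuous_on_truncation: "continuous_on (extended_space l n) truncation"
proof -
  let ?E = "extended_space l n"
  have coord: "continuous_on ?E (\<lambda>d. d i)" for i
    by (rule continuous_on_subset[OF continuous_on_product_coordinates]) simp
  have central: "continuous_on ?E (\<lambda>d. real_of_ereal (d i))" if "i \<in> {l+1..n}" for i
    by (rule continuous_on_compose2[OF continuous_on_real coord])
      (use extended_spaceD(2)[OF _ that] in force)
  have part: "continuous_on ?E (\<lambda>d. f i \<bullet> central_part d)" for i
    unfolding central_part_def by (intro continuous_intros central)
  have upper: "continuous_on ?E (\<lambda>d. real_of_ereal (max (d i) (ereal (f i \<bullet> central_part d))))"
    if "i \<in> {1..l}" for i
  proof (rule continuous_on_compose2[OF continuous_on_real])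
    show "continuous_on ?E (\<lambda>d. max (d i) (ereal (f i \<bullet> central_part d)))"
      by (intro continuous_on_max coord continuous_on_ereal part)
    show "(\<lambda>d. max (d i) (ereal (f i \<bullet> central_part d))) ` ?E \<subseteq> UNIV - {\<infinity>, -\<infinity>}"
      using extended_spaceD(1)[OF _ that] by (auto simp: max_def)
  qed
  have "continuous_on ?E (\<lambda>d. (if i \<in> {1..l}
     then real_of_ereal (max (d i) (ereal (f i \<bullet> central_part d))) else real_of_ereal (d i)) *\<^sub>R e i)"
    if "i \<in> {1..n}" for i
    using that upper[of i] central[of i]
    by (cases "i \<in> {1..l}") (auto intro!: continuous_on_scaleR continuous_on_const)
  then show ?thesis unfolding truncation_def by (rule continuous_on_sum)
qed

lemma coords_in_extended_space: "coords rp \<omega> n x \<in> extended_space l n"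
  unfolding extended_space_def mem_Collect_eq coords_def by (auto split: if_splits)

text \<open>Cut the coordinates of \<open>d\<close> off at \<open>-k\<close> and let \<open>k\<close> tend to infinity.\<close>

lemma coords_dense:
  assumes d: "d \<in> extended_space l n"
  shows "\<exists>y. (\<lambda>k. coords rp \<omega> n (y k)) \<longlonglongrightarrow> d"
proof -
  define s where "s k i = (if i \<in> {1..l} then max (d i) (ereal (- real k)) else d i)" for k i
  define y where "y k = (\<Sum>i\<in>{1..n}. real_of_ereal (s k i) *\<^sub>R e i)" for k
  have finite_s: "\<bar>s k i\<bar> \<noteq> \<infinity>" if "i \<in> {1..n}" for k i
  proof (cases "i \<in> {1..l}")
    case True
    then have "d i \<noteq> \<infinity>" by (rule extended_spaceD(1)[OF d])
    then show ?thesis using True by (cases "d i") (auto simp: s_def max_def)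
  next
    case False
    then show ?thesis using extended_spaceD(2)[OF d, of i] that by (auto simp: s_def)
  qed
  have "coords rp \<omega> n (y k) = s k" for k
  proof
    fix i show "coords rp \<omega> n (y k) i = s k i"
    proof (cases "i \<in> {1..n}")
      case True
      have "f i \<bullet> y k = real_of_ereal (s k i)" unfolding y_def by (rule f_sum[OF True])
      then show ?thesis using True finite_s[OF True, of k]
        by (simp add: coords_def rp_weight ereal_real)
    next
      case False
      then have "d i = 0" "i \<notin> {1..l}" using extended_spaceD(3)[OF d] index_cases by blast+
      then show ?thesis using False by (auto simp: coords_def s_def)
    qed
  qed
  moreover have "s \<longlonglongrightarrow> d"
  proof (rule tendsto_fun_coordinatewise)
    fix i show "(\<lambda>k. s k i) \<longlonglongrightarrow> d i"
    proof (cases "i \<in> {1..l}")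
      case True
      have "(\<lambda>k. ereal (- real k)) \<longlonglongrightarrow> -\<infinity>"
        using filterlim_compose[OF filterlim_uminus_at_bot_at_top filterlim_real_sequentially]
        by (simp flip: ereal_tendsto_simps add: comp_def)
      then have "(\<lambda>k. max (d i) (ereal (- real k))) \<longlonglongrightarrow> max (d i) (-\<infinity>)"
        by (intro tendsto_max tendsto_const)
      then show ?thesis using True by (simp add: s_def)
    next
      case False
      then have "(\<lambda>k. s k i) = (\<lambda>k. d i)" by (auto simp: s_def)
      then show ?thesis by simp
    qed
  qed
  ultimately show ?thesis by (intro exI[of _ y]) simp
qed

text \<open>The right-hand side is continuous, as truncation is, and extends \<open>r\<close> by
  \<open>retraction_truncation_coords\<close>; continuity and density determine the extension.\<close>

theorem extended_retraction_eq:
  "extended_retraction rp \<alpha> l \<omega> n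
     = restrict (\<lambda>d. retraction_dom rp \<alpha> l (truncation d)) (extended_space l n)" (is "_ = ?R")
  unfolding extended_retraction_def
proof (rule the_equality)
  let ?E = "extended_space l n"
  have "continuous_on ?E (\<lambda>d. retraction_dom rp \<alpha> l (truncation d))"
    unfolding retraction_dom_def
    by (rule continuous_on_compose2[OF
        continuous_on_closest_point[OF convex_dominant closed_dominant dominant_nonempty, of UNIV]
        continuous_on_truncation]) simp
  then have cont: "continuous_on ?E ?R" by (rule continuous_on_eq) simp
  have restr: "?R (coords rp \<omega> n x) = retraction_dom rp \<alpha> l x" for x
    using coords_in_extended_space[of x] retraction_truncation_coords[of x] by simp
  show "?R \<in> ?E \<rightarrow>\<^sub>E dominant rp \<alpha> l \<and> continuous_on ?E ?R
      \<and> (\<forall>x. ?R (coords rp \<omega> n x) = retraction_dom rp \<alpha> l x)"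
    using cont restr retraction_dominant by auto
  fix R assume R: "R \<in> ?E \<rightarrow>\<^sub>E dominant rp \<alpha> l \<and> continuous_on ?E R
      \<and> (\<forall>x. R (coords rp \<omega> n x) = retraction_dom rp \<alpha> l x)"
  show "R = ?R"
  proof
    fix d show "R d = ?R d"
    proof (cases "d \<in> ?E")
      case True
      obtain y where y: "(\<lambda>k. coords rp \<omega> n (y k)) \<longlonglongrightarrow> d" using coords_dense[OF True] by blast
      have "(\<lambda>k. R (coords rp \<omega> n (y k))) \<longlonglongrightarrow> R d"
        using R coords_in_extended_space
        by (intro continuous_on_tendsto_compose[OF _ y True]) auto
      moreover have "(\<lambda>k. ?R (coords rp \<omega> n (y k))) \<longlonglongrightarrow> ?R d"
        using coords_in_extended_space
        by (intro continuous_on_tendsto_compose[OF cont y True]) auto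
      ultimately show ?thesis using R unfolding restr by (auto intro: LIMSEQ_unique)
    next
      case False
      then show ?thesis using R PiE_arb[of R ?E "\<lambda>_. dominant rp \<alpha> l" d] by simp
    qed
  qed
qed

end

section \<open>Valuations of sums\<close>

context neg_valuation
begin

lemma v_one: "v 1 = 0"
  using v_mult[of 1 1] by simp

lemma v_uminus: "x \<noteq> 0 \<Longrightarrow> v (- x) = v x"
proof -
  have "v (- 1) + v (- 1) = 0" using v_mult[of "- 1" "- 1"] v_one by simp
  then have "v (- 1) = 0" by simp
  then show "x \<noteq> 0 \<Longrightarrow> v (- x) = v x" using v_mult[of "- 1" x] by simp
qed

lemma val_uminus: "val v (- x) = val v x"
  by (simp add: val_def v_uminus)

lemma val_add: "val v (x + y) \<le> max (val v x) (val v y)"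
proof (cases "x = 0 \<or> y = 0 \<or> x + y = 0")
  case False
  then have "v (x + y) \<le> max (v x) (v y)" using v_add by blast
  then have "(of_rat (v (x + y)) :: real) \<le> max (of_rat (v x)) (of_rat (v y))"
    by (auto simp: max_def of_rat_less_eq split: if_splits)
  then show ?thesis using False by (simp add: val_def flip: ereal_max)
qed (auto simp: val_def)

lemma val_sum_le: "(\<And>x. x \<in> S \<Longrightarrow> val v (g x) \<le> M) \<Longrightarrow> val v (sum g S) \<le> M"
proof (induction S rule: infinite_finite_induct)
  case (insert x S)
  then have "max (val v (g x)) (val v (sum g S)) \<le> M" by simp
  then show ?case using val_add[of "g x" "sum g S"] insert.hyps order_trans by fastforce
qed (auto simp: val_def)

lemma val_sum_less:
  "-\<infinity> < M \<Longrightarrow> (\<And>x. x \<in> S \<Longrightarrow> val v (g x) < M) \<Longrightarrow> val v (sum g S) < M"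
proof (induction S rule: infinite_finite_induct)
  case (insert x S)
  then have "max (val v (g x)) (val v (sum g S)) < M" by simp
  then show ?case using val_add[of "g x" "sum g S"] insert.hyps le_less_trans by fastforce
qed (auto simp: val_def)

text \<open>If the sum had smaller valuation than the dominating summand \<open>g s\<close>, then so would
  \<open>g s\<close> itself, being the sum minus the other summands.\<close>

lemma val_sum_unique_max:
  assumes "finite S" "s \<in> S" "g s \<noteq> 0" "\<And>t. t \<in> S \<Longrightarrow> t \<noteq> s \<Longrightarrow> val v (g t) < val v (g s)"
  shows "val v (sum g S) = val v (g s)"
proof -
  let ?r = "sum g (S - {s})"
  have r: "val v ?r < val v (g s)"
    by (rule val_sum_less) (use assms in \<open>auto simp: val_def\<close>)
  have sum: "sum g S = g s + ?r" using assms(1,2) by (rule sum.remove)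
  have "val v (g s) \<le> max (val v (sum g S)) (val v (- ?r))"
    using val_add[of "sum g S" "- ?r"] unfolding sum by simp
  then have "val v (g s) \<le> val v (sum g S)" using r by (auto simp: val_uminus max_def split: if_splits)
  moreover have "val v (sum g S) \<le> val v (g s)"
    using val_add[of "g s" ?r] r unfolding sum by (auto simp: max_def split: if_splits)
  ultimately show ?thesis by simp
qed

end

section \<open>Root data as Euclidean root systems\<close>

lemma additive_zsmul:
  fixes \<phi> :: "'a::ab_group_add \<Rightarrow> 'b::real_vector"
  assumes "\<And>x y. \<phi> (x + y) = \<phi> x + \<phi> y"
  shows "\<phi> (zsmul k x) = of_int k *\<^sub>R \<phi> x"
proof -
  interpret Modules.additive \<phi> by unfold_locales (rule assms)
  have "\<phi> (zsmul k x) = real (nat k) *\<^sub>R \<phi> x - real (nat (- k)) *\<^sub>R \<phi> x"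
    unfolding zsmul_def by (simp only: diff sum sum_constant_scaleR card_lessThan)
  also have "\<dots> = of_int k *\<^sub>R \<phi> x"
    unfolding scaleR_left_diff_distrib[symmetric] by (rule arg_cong[where f = "\<lambda>c. c *\<^sub>R \<phi> x"]) simp
  finally show ?thesis .
qed

context root_datum
begin

lemma cocharacter_eqI: "(\<And>\<mu>. pr \<mu> y = pr \<mu> y') \<Longrightarrow> y = y'"
  using perfect_right[of "\<lambda>\<mu>. pr \<mu> y"] by (auto simp: Modules.additive_def pr_add_left)

lemma weight_eqI: "(\<And>y. pr \<mu> y = pr \<mu>' y) \<Longrightarrow> \<mu> = \<mu>'"
  using perfect_left[of "\<lambda>y. pr \<mu> y"] by (auto simp: Modules.additive_def pr_add_right)

text \<open>The coordinates with respect to a basis of the characters are additive, and by perfectness of the pairing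
  they are given by cocharacters.\<close>

lemma dual_basis_exists:
  "\<exists>B y. finite B \<and> card B = n \<and> (\<forall>\<mu>. (\<Sum>b\<in>B. zsmul (pr \<mu> (y b)) b) = \<mu>)"
proof -
  obtain B :: "'x set" where B: "finite B" "card B = n" "\<not> zmod.dependent B" "zmod.span B = UNIV"
    using free unfolding z_basis_of_def by blast
  have "\<exists>y. \<forall>\<mu>. zmod.representation B \<mu> b = pr \<mu> y" for b
  proof -
    have "Modules.additive (\<lambda>\<mu>. zmod.representation B \<mu> b)"
      unfolding Modules.additive_def using zmod.representation_add[OF B(3)] B(4) by simp
    from perfect_right[OF this] show ?thesis by blast
  qed
  then obtain y where y: "zmod.representation B \<mu> b = pr \<mu> (y b)" for \<mu> b by metis
  have "(\<Sum>b\<in>B. zsmul (pr \<mu> (y b)) b) = \<mu>" for \<mu>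
    unfolding y[symmetric] by (rule zmod.sum_representation_eq) (use B in auto)
  then show ?thesis using B by blast
qed

end

context real_cocharacters
begin

lemma iota_zsmul: "\<iota> (zsmul k y) = of_int k *\<^sub>R \<iota> y"
  by (rule additive_zsmul) (rule iota_add)

lemma iota_sum: "\<iota> (sum h S) = (\<Sum>s\<in>S. \<iota> (h s))"
proof -
  interpret Modules.additive \<iota> by unfold_locales (rule iota_add)
  show ?thesis by (rule sum)
qed

lemma rp_add_weight: "rp (\<mu> + \<mu>') x = rp \<mu> x + rp \<mu>' x"
proof (rule linear_eq_on_span[of "rp (\<mu> + \<mu>')" "\<lambda>x. rp \<mu> x + rp \<mu>' x" "range \<iota>"])
  show "linear (\<lambda>x. rp \<mu> x + rp \<mu>' x)" by (intro linear_compose_add rp_linear)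
qed (use rp_linear span_iota rp_iota pr_add_left in auto)

lemma rp_zsmul_weight: "rp (zsmul k \<mu>) x = of_int k * rp \<mu> x"
  using additive_zsmul[of "\<lambda>\<mu>. rp \<mu> x" k \<mu>] rp_add_weight by simp

text \<open>On the lattice the expansion holds because both sides have the same pairings with all characters; the
  lattice spans, and both sides are linear.\<close>

lemma real_expansion_exists:
  "\<exists>B y. finite B \<and> card B = n \<and> (\<forall>\<mu>. (\<Sum>b\<in>B. zsmul (pr \<mu> (y b)) b) = \<mu>)
      \<and> (\<forall>x. (\<Sum>b\<in>B. rp b x *\<^sub>R \<iota> (y b)) = x)"
proof -
  obtain B y where B: "finite B" "card B = n" "\<And>\<mu>. (\<Sum>b\<in>B. zsmul (pr \<mu> (y b)) b) = \<mu>"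
    using dual_basis_exists by blast
  have on_lattice: "(\<Sum>b\<in>B. rp b (\<iota> z) *\<^sub>R \<iota> (y b)) = \<iota> z" for z
  proof -
    have "real_of_int (pr \<mu> (\<Sum>b\<in>B. zsmul (pr b z) (y b))) = real_of_int (pr \<mu> z)" for \<mu>
    proof -
      have "rp \<mu> (\<Sum>b\<in>B. of_int (pr b z) *\<^sub>R \<iota> (y b)) = (\<Sum>b\<in>B. of_int (pr b z) * rp \<mu> (\<iota> (y b)))"
        using rp_linear[of \<mu>] by (simp add: linear_sum linear_scale)
      also have "\<dots> = (\<Sum>b\<in>B. rp (zsmul (pr \<mu> (y b)) b) (\<iota> z))"
        by (rule sum.cong[OF refl], subst rp_zsmul_weight) (simp add: rp_iota)
      also have "\<dots> = rp (\<Sum>b\<in>B. zsmul (pr \<mu> (y b)) b) (\<iota> z)"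
      proof -
        interpret Modules.additive "\<lambda>\<mu>. rp \<mu> (\<iota> z)" by unfold_locales (rule rp_add_weight)
        show ?thesis by (rule sum[symmetric])
      qed
      finally show ?thesis unfolding B(3) by (simp add: iota_sum iota_zsmul flip: rp_iota)
    qed
    then have "(\<Sum>b\<in>B. zsmul (pr b z) (y b)) = z" by (intro cocharacter_eqI) simp
    from arg_cong[OF this, of \<iota>] show ?thesis by (simp add: iota_sum iota_zsmul rp_iota)
  qed
  have "(\<Sum>b\<in>B. rp b x *\<^sub>R \<iota> (y b)) = x" for x
  proof (rule linear_eq_on_span[of "\<lambda>x. \<Sum>b\<in>B. rp b x *\<^sub>R \<iota> (y b)" "\<lambda>x. x" "range \<iota>"])
    show "linear (\<lambda>x. \<Sum>b\<in>B. rp b x *\<^sub>R \<iota> (y b))"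
      by (rule linearI)
        (simp_all add: linear_add[OF rp_linear] linear_scale[OF rp_linear] scaleR_left_distrib
          sum.distrib scaleR_sum_right)
    show "linear (\<lambda>x::'v. x)" by (rule linear_ident)
  qed (use span_iota on_lattice in auto)
  then show ?thesis using B by blast
qed

lemma rp_separates:
  assumes "\<And>\<mu>. rp \<mu> x = rp \<mu> x'"
  shows "x = x'"
proof -
  obtain B y where B: "\<forall>x. (\<Sum>b\<in>B. rp b x *\<^sub>R \<iota> (y b)) = x"
    using real_expansion_exists by blast
  have "x = (\<Sum>b\<in>B. rp b x *\<^sub>R \<iota> (y b))" using B by simp
  also have "\<dots> = x'" unfolding assms using B by simp
  finally show ?thesis .
qed

lemma additive_represented:
  assumes "\<And>\<mu> \<mu>'. \<phi> (\<mu> + \<mu>') = \<phi> \<mu> + \<phi> \<mu>'"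
  shows "\<exists>x. \<forall>\<mu>. rp \<mu> x = \<phi> \<mu>"
proof -
  obtain B y where B: "\<And>\<mu>. (\<Sum>b\<in>B. zsmul (pr \<mu> (y b)) b) = \<mu>"
    using dual_basis_exists by blast
  interpret Modules.additive \<phi> by unfold_locales (rule assms)
  have "rp \<mu> (\<Sum>b\<in>B. \<phi> b *\<^sub>R \<iota> (y b)) = \<phi> \<mu>" for \<mu>
  proof -
    have "\<phi> \<mu> = (\<Sum>b\<in>B. \<phi> (zsmul (pr \<mu> (y b)) b))" by (subst B[of \<mu>, symmetric]) (rule sum)
    also have "\<dots> = (\<Sum>b\<in>B. \<phi> b * rp \<mu> (\<iota> (y b)))"
      by (simp add: additive_zsmul[of \<phi>] assms rp_iota mult.commute)
    also have "\<dots> = rp \<mu> (\<Sum>b\<in>B. \<phi> b *\<^sub>R \<iota> (y b))"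
      using rp_linear[of \<mu>] by (simp add: linear_sum linear_scale)
    finally show ?thesis by simp
  qed
  then show ?thesis by blast
qed

text \<open>The vector that represents the linear form of a character with respect to the inner product.\<close>

definition weight_vector :: "'x \<Rightarrow> 'v" where
  "weight_vector \<mu> = (SOME f. \<forall>x. f \<bullet> x = rp \<mu> x)"

lemma weight_vector_inner: "weight_vector \<mu> \<bullet> x = rp \<mu> x"
proof -
  obtain B y where B: "finite B" "\<And>x. (\<Sum>b\<in>B. rp b x *\<^sub>R \<iota> (y b)) = x"
    using real_expansion_exists by blast
  have "x \<in> span ((\<lambda>b. \<iota> (y b)) ` B)" for x
    by (subst B(2)[of x, symmetric]) (intro span_sum span_scale span_base imageI)
  then have "span ((\<lambda>b. \<iota> (y b)) ` B) = UNIV" by blast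
  then obtain f where "\<And>x. f \<bullet> x = rp \<mu> x"
    using linear_functional_representer[OF finite_imageI[OF B(1)] _ rp_linear] by metis
  then have "\<exists>f. \<forall>x. f \<bullet> x = rp \<mu> x" by blast
  from someI_ex[OF this] show ?thesis unfolding weight_vector_def by blast
qed

lemma weight_vector_eqI: "(\<And>x. f \<bullet> x = rp \<mu> x) \<Longrightarrow> f = weight_vector \<mu>"
  using vector_eq_rdot[of f "weight_vector \<mu>"] by (simp add: weight_vector_inner)

lemma weight_vector_add: "weight_vector (\<mu> + \<mu>') = weight_vector \<mu> + weight_vector \<mu>'"
  by (rule weight_vector_eqI[symmetric]) (simp add: inner_add_left weight_vector_inner rp_add_weight)

lemma weight_vector_zsmul: "weight_vector (zsmul k \<mu>) = of_int k *\<^sub>R weight_vector \<mu>"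
  by (rule additive_zsmul) (rule weight_vector_add)

lemma weight_vector_diff: "weight_vector (\<mu> - \<mu>') = weight_vector \<mu> - weight_vector \<mu>'"
  using weight_vector_add[of "\<mu> - \<mu>'" \<mu>'] by simp

lemma weight_vector_uminus: "weight_vector (- \<mu>) = - weight_vector \<mu>"
  using weight_vector_zsmul[of "- 1" \<mu>] by (simp add: zsmul_minus zsmul_one)

lemma weight_vector_sum: "weight_vector (sum h S) = (\<Sum>s\<in>S. weight_vector (h s))"
proof -
  interpret Modules.additive weight_vector by unfold_locales (rule weight_vector_add)
  show ?thesis by (rule sum)
qed

lemma weight_vector_inj: "weight_vector \<mu> = weight_vector \<mu>' \<Longrightarrow> \<mu> = \<mu>'"
  by (rule weight_eqI) (metis weight_vector_inner rp_iota of_int_eq_iff)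

lemma weyl_act_eqI:
  assumes "surj w" "\<And>\<mu>. rp (w \<mu>) y = rp \<mu> x"
  shows "weyl_act rp w x = y"
  unfolding weyl_act_def
proof (rule the_equality)
  fix z assume z: "\<forall>\<mu>. rp (w \<mu>) z = rp \<mu> x"
  show "z = y"
  proof (rule rp_separates)
    fix \<mu> obtain \<mu>' where "\<mu> = w \<mu>'" using assms(1) by blast
    then show "rp \<mu> z = rp \<mu> y" using z assms(2) by simp
  qed
qed (use assms in auto)

lemma rp_reflection: "rp (reflection pr coroot \<beta> \<mu>) x = rp \<mu> x - of_int (pr \<mu> (coroot \<beta>)) * rp \<beta> x"
  unfolding reflection_def
  by (simp add: weight_vector_diff weight_vector_zsmul inner_diff_left flip: weight_vector_inner)

lemma reflection_involutive:
  assumes "\<beta> \<in> roots"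
  shows "reflection pr coroot \<beta> (reflection pr coroot \<beta> \<mu>) = \<mu>"
proof (rule weight_vector_inj, rule weight_vector_eqI[symmetric])
  have "real_of_int (pr (reflection pr coroot \<beta> \<mu>) (coroot \<beta>)) = - of_int (pr \<mu> (coroot \<beta>))"
    using rp_reflection[of \<beta> \<mu> "\<iota> (coroot \<beta>)"] pr_root_coroot[OF assms] by (simp add: rp_iota)
  then show "weight_vector \<mu> \<bullet> x = rp (reflection pr coroot \<beta> (reflection pr coroot \<beta> \<mu>)) x" for x
    by (simp add: rp_reflection weight_vector_inner)
qed

lemma surj_reflection: "\<beta> \<in> roots \<Longrightarrow> surj (reflection pr coroot \<beta>)"
  by (rule surjI) (rule reflection_involutive)

lemma reflection_in_weyl_group: "\<beta> \<in> roots \<Longrightarrow> reflection pr coroot \<beta> \<in> weyl_group pr roots coroot"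
  using weyl_group.step[OF weyl_group.one, of \<beta> roots pr coroot] by simp

lemma weyl_act_reflection:
  assumes "\<beta> \<in> roots"
  shows "weyl_act rp (reflection pr coroot \<beta>) x = x - rp \<beta> x *\<^sub>R \<iota> (coroot \<beta>)"
proof (rule weyl_act_eqI[OF surj_reflection[OF assms]])
  fix \<mu>
  have act: "rp \<mu>' (x - rp \<beta> x *\<^sub>R \<iota> (coroot \<beta>)) = rp \<mu>' x - rp \<beta> x * of_int (pr \<mu>' (coroot \<beta>))" for \<mu>'
    using rp_linear[of \<mu>'] by (simp add: linear_diff linear_scale rp_iota)
  show "rp (reflection pr coroot \<beta> \<mu>) (x - rp \<beta> x *\<^sub>R \<iota> (coroot \<beta>)) = rp \<mu> x"
    unfolding rp_reflection act[of \<mu>] act[of \<beta>] by (simp add: pr_root_coroot[OF assms])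
qed

text \<open>The reflection of a root is an isometry that negates the coroot, and this forces the root and
  the coroot to be proportional.\<close>

lemma coroot_vector:
  assumes "\<beta> \<in> roots"
  shows "weight_vector \<beta> \<noteq> 0"
    and "\<iota> (coroot \<beta>) = (2 / (weight_vector \<beta> \<bullet> weight_vector \<beta>)) *\<^sub>R weight_vector \<beta>"
proof -
  let ?c = "\<iota> (coroot \<beta>)"
  have two: "rp \<beta> ?c = 2" using pr_root_coroot[OF assms] by (simp add: rp_iota)
  show nz: "weight_vector \<beta> \<noteq> 0" using two weight_vector_inner[of \<beta> ?c] by auto
  have c_nz: "?c \<noteq> 0" using two weight_vector_inner[of \<beta> ?c] by auto
  have "(?c \<bullet> ?c) *\<^sub>R weight_vector \<beta> = 2 *\<^sub>R ?c"
  proof -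
    have "(?c \<bullet> ?c) * rp \<beta> x = 2 * (?c \<bullet> x)" for x
    proof -
      \<comment> \<open>The second factor is \<open>- ?c\<close>, because \<open>rp \<beta> ?c = 2\<close>.\<close>
      have "(x - rp \<beta> x *\<^sub>R ?c) \<bullet> (?c - rp \<beta> ?c *\<^sub>R ?c) = x \<bullet> ?c"
        using weyl_invariant[OF reflection_in_weyl_group[OF assms], of x ?c]
        unfolding weyl_act_reflection[OF assms] .
      then show ?thesis unfolding two by (simp add: algebra_simps inner_commute scaleR_2)
    qed
    then have "((?c \<bullet> ?c) *\<^sub>R weight_vector \<beta>) \<bullet> x = (2 *\<^sub>R ?c) \<bullet> x" for x
      by (simp add: weight_vector_inner)
    then show ?thesis using vector_eq_rdot by blast
  qed
  then have w: "weight_vector \<beta> = (2 / (?c \<bullet> ?c)) *\<^sub>R ?c"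
    using c_nz by (metis (no_types, lifting) divide_inverse inner_eq_zero_iff mult.commute right_inverse scaleR_one scaleR_scaleR)
  have "weight_vector \<beta> \<bullet> weight_vector \<beta> = 4 / (?c \<bullet> ?c)"
    unfolding w using c_nz by simp
  then show "?c = (2 / (weight_vector \<beta> \<bullet> weight_vector \<beta>)) *\<^sub>R weight_vector \<beta>"
    using c_nz by (simp add: w)
qed

lemma weight_vector_reflection:
  assumes "\<beta> \<in> roots"
  shows "weight_vector (reflection pr coroot \<beta> \<mu>) = mirror (weight_vector \<beta>) (weight_vector \<mu>)"
proof -
  have "real_of_int (pr \<mu> (coroot \<beta>)) = weight_vector \<mu> \<bullet> \<iota> (coroot \<beta>)"
    by (simp add: weight_vector_inner rp_iota)
  then show ?thesis unfolding reflection_def mirror_def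
    by (simp add: weight_vector_diff weight_vector_zsmul coroot_vector(2)[OF assms])
qed

text \<open>\<open>u\<close> is the isometry by which the Weyl group element \<open>w\<close> acts, both on the vectors of characters and
  on \<open>X\<^sub>*(A) \<otimes> \<real>\<close>.\<close>

definition weyl_pair :: "('x \<Rightarrow> 'x) \<Rightarrow> ('v \<Rightarrow> 'v) \<Rightarrow> bool" where
  "weyl_pair w u \<longleftrightarrow> (\<forall>\<mu>. weight_vector (w \<mu>) = u (weight_vector \<mu>)) \<and> (\<forall>x. weyl_act rp w x = u x)"

lemma weyl_pairI:
  assumes "u \<in> mirror_group (weight_vector ` roots)" "surj w"
    and "\<And>\<mu>. weight_vector (w \<mu>) = u (weight_vector \<mu>)"
  shows "weyl_pair w u"
proof -
  have "rp (w \<mu>) (u x) = rp \<mu> x" for \<mu> x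
  proof -
    have "rp (w \<mu>) (u x) = u (weight_vector \<mu>) \<bullet> u x"
      by (simp only: weight_vector_inner flip: assms(3))
    also have "\<dots> = rp \<mu> x" by (simp only: mirror_group_inner[OF assms(1)] weight_vector_inner)
    finally show ?thesis .
  qed
  then have "weyl_act rp w x = u x" for x by (rule weyl_act_eqI[OF assms(2)])
  then show ?thesis using assms(3) by (simp add: weyl_pair_def)
qed

lemma surj_weyl_group: "w \<in> weyl_group pr roots coroot \<Longrightarrow> surj w"
proof (induction rule: weyl_group.induct)
  case one
  show ?case by (rule surj_id)
next
  case (step w \<beta>)
  show ?case by (rule comp_surj[OF step.IH surj_reflection[OF step.hyps(2)]])
qed

lemma weyl_group_mirror:
  "w \<in> weyl_group pr roots coroot \<Longrightarrow> \<exists>u\<in>mirror_group (weight_vector ` roots). weyl_pair w u"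
proof (induction rule: weyl_group.induct)
  case one
  show ?case by (intro bexI[of _ id] weyl_pairI mirror_group.one) auto
next
  case (step w \<beta>)
  then obtain u where u: "u \<in> mirror_group (weight_vector ` roots)" "weyl_pair w u" by blast
  let ?u = "mirror (weight_vector \<beta>) \<circ> u"
  have "?u \<in> mirror_group (weight_vector ` roots)" using u step.hyps by (blast intro: mirror_group.step)
  moreover have "weyl_pair (reflection pr coroot \<beta> \<circ> w) ?u"
    using calculation surj_weyl_group[OF weyl_group.step[OF step.hyps]] u(2)
    by (intro weyl_pairI) (simp_all add: weight_vector_reflection[OF step.hyps(2)] weyl_pair_def)
  ultimately show ?case by blast
qed

lemma mirror_weyl_group:
  "u \<in> mirror_group (weight_vector ` roots) \<Longrightarrow> \<exists>w\<in>weyl_group pr roots coroot. weyl_pair w u"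
proof (induction rule: mirror_group.induct)
  case one
  have "weyl_pair id id" by (rule weyl_pairI[OF mirror_group.one]) auto
  then show ?case using weyl_group.one by (rule bexI)
next
  case (step u \<gamma>)
  from step.IH obtain w where w: "w \<in> weyl_group pr roots coroot" "weyl_pair w u" ..
  obtain \<beta> where \<beta>: "\<beta> \<in> roots" "\<gamma> = weight_vector \<beta>" using step.hyps(2) by (rule imageE)
  have grp: "reflection pr coroot \<beta> \<circ> w \<in> weyl_group pr roots coroot"
    using w(1) \<beta>(1) by (rule weyl_group.step)
  have "weyl_pair (reflection pr coroot \<beta> \<circ> w) (mirror \<gamma> \<circ> u)"
    using mirror_group.step[OF step.hyps] surj_weyl_group[OF grp] w(2) \<beta>
    by (intro weyl_pairI) (simp_all add: weight_vector_reflection weyl_pair_def)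
  then show ?case using grp by blast
qed

end

section \<open>Fundamental weights and their dual frame\<close>

locale weighted_torus = adapted_weights pr roots coroot n \<alpha> l \<omega>
    + real_cocharacters pr roots coroot n \<iota> rp
  for pr :: "'x::ab_group_add \<Rightarrow> 'y::ab_group_add \<Rightarrow> int"
    and roots :: "'x set" and coroot :: "'x \<Rightarrow> 'y" and n :: nat
    and \<alpha> :: "nat \<Rightarrow> 'x" and l :: nat and \<omega> :: "nat \<Rightarrow> 'x"
    and \<iota> :: "'y \<Rightarrow> 'v::{real_inner, heine_borel}" and rp :: "'x \<Rightarrow> 'v \<Rightarrow> real"
begin

lemma simple_root: "i \<in> {1..l} \<Longrightarrow> \<alpha> i \<in> roots"
  using simple_roots by blast

lemma pr_coroot:
  assumes "\<beta> \<in> roots"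
  shows "real_of_int (pr \<mu> (coroot \<beta>))
     = 2 / (weight_vector \<beta> \<bullet> weight_vector \<beta>) * (weight_vector \<mu> \<bullet> weight_vector \<beta>)"
proof -
  have "real_of_int (pr \<mu> (coroot \<beta>)) = weight_vector \<mu> \<bullet> \<iota> (coroot \<beta>)"
    by (simp only: weight_vector_inner rp_iota)
  then show ?thesis unfolding coroot_vector(2)[OF assms] by simp
qed

lemma root_vector_pos: "\<beta> \<in> roots \<Longrightarrow> 0 < weight_vector \<beta> \<bullet> weight_vector \<beta>"
  using coroot_vector(1) by simp

text \<open>As the derived group is simply connected, the characters of \<open>D\<close> are those that vanish on all coroots.\<close>

lemma central_weight_coroot:
  assumes "i \<in> {l+1..n}" "\<beta> \<in> roots"
  shows "pr (\<omega> i) (coroot \<beta>) = 0"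
proof -
  have "\<omega> i \<in> zmod.span (\<omega> ` {l+1..n})" using assms(1) by (intro zmod.span_base imageI)
  then have "\<omega> i \<in> D_characters pr roots coroot" using central unfolding z_basis_of_def by simp
  moreover have "coroot \<beta> \<in> derived_cocharacters roots coroot"
    using sc assms(2) unfolding sc_derived_def coroot_lattice_def
    by (simp add: zmod.span_base)
  ultimately show ?thesis unfolding D_characters_def by blast
qed

lemma weight_vector_simple_inner:
  assumes "i \<in> {1..l}" "j \<in> {1..l}"
  shows "weight_vector (\<omega> i) \<bullet> weight_vector (\<alpha> j)
    = (if i = j then (weight_vector (\<alpha> j) \<bullet> weight_vector (\<alpha> j)) / 2 else 0)"
proof -
  have "2 / (weight_vector (\<alpha> j) \<bullet> weight_vector (\<alpha> j)) * (weight_vector (\<omega> i) \<bullet> weight_vector (\<alpha> j))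
      = (if i = j then 1 else 0)"
    unfolding pr_coroot[OF simple_root[OF assms(2)], symmetric] fundamental[OF assms] by simp
  then show ?thesis using root_vector_pos[OF simple_root[OF assms(2)]]
    by (cases "i = j") (simp_all add: divide_eq_eq)
qed

lemma weight_vector_simple_combination:
  "weight_vector (\<Sum>i\<in>{1..l}. zsmul (int (m i)) (\<alpha> i)) = (\<Sum>i\<in>{1..l}. real (m i) *\<^sub>R weight_vector (\<alpha> i))"
  by (simp add: weight_vector_sum weight_vector_zsmul)

sublocale system: simple_system "weight_vector ` roots" "\<lambda>i. weight_vector (\<alpha> i)" "{1..l}"
proof unfold_locales
  show "finite (weight_vector ` roots)" using finite_roots by (rule finite_imageI)
  show "0 \<notin> weight_vector ` roots" using coroot_vector(1) by force
  show "mirror \<beta> \<gamma> \<in> weight_vector ` roots"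
    if \<beta>\<gamma>: "\<beta> \<in> weight_vector ` roots" "\<gamma> \<in> weight_vector ` roots" for \<beta> \<gamma>
  proof -
    obtain b where b: "b \<in> roots" "\<beta> = weight_vector b" using \<beta>\<gamma>(1) by (rule imageE)
    obtain c where c: "c \<in> roots" "\<gamma> = weight_vector c" using \<beta>\<gamma>(2) by (rule imageE)
    have "reflection pr coroot b c \<in> roots" using reflection_roots[OF b(1)] c(1) by blast
    then show ?thesis unfolding b(2) c(2) weight_vector_reflection[OF b(1), symmetric] by (rule imageI)
  qed
  show "finite {1..l}" by simp
  show "weight_vector (\<alpha> i) \<in> weight_vector ` roots" if "i \<in> {1..l}" for i
    using simple_root[OF that] by (rule imageI)
  show "c i = 0" if zero: "(\<Sum>i\<in>{1..l}. c i *\<^sub>R weight_vector (\<alpha> i)) = 0" and i: "i \<in> {1..l}"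
    for c :: "nat \<Rightarrow> real" and i
  proof -
    have "0 = weight_vector (\<omega> i) \<bullet> (\<Sum>i\<in>{1..l}. c i *\<^sub>R weight_vector (\<alpha> i))"
      unfolding zero by simp
    also have "\<dots> = (\<Sum>j\<in>{1..l}. if i = j
        then c i * ((weight_vector (\<alpha> i) \<bullet> weight_vector (\<alpha> i)) / 2) else 0)"
      unfolding inner_sum_right by (rule sum.cong) (use i weight_vector_simple_inner in auto)
    also have "\<dots> = c i * ((weight_vector (\<alpha> i) \<bullet> weight_vector (\<alpha> i)) / 2)" using i by simp
    finally show ?thesis using root_vector_pos[OF simple_root[OF i]] by simp
  qed
  show "\<exists>m :: nat \<Rightarrow> nat. \<beta> = (\<Sum>i\<in>{1..l}. real (m i) *\<^sub>R weight_vector (\<alpha> i))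
      \<or> \<beta> = - (\<Sum>i\<in>{1..l}. real (m i) *\<^sub>R weight_vector (\<alpha> i))"
    if \<beta>: "\<beta> \<in> weight_vector ` roots" for \<beta>
  proof -
    obtain b where b: "b \<in> roots" "\<beta> = weight_vector b" using \<beta> by (rule imageE)
    from pos_or_neg[OF b(1)] obtain m :: "nat \<Rightarrow> nat" where
      "b = (\<Sum>i\<in>{1..l}. zsmul (int (m i)) (\<alpha> i)) \<or> b = - (\<Sum>i\<in>{1..l}. zsmul (int (m i)) (\<alpha> i))" ..
    then show ?thesis unfolding b(2)
      by (metis weight_vector_simple_combination weight_vector_uminus)
  qed
  show "k = 1" if i: "i \<in> {1..l}" and k: "real k *\<^sub>R weight_vector (\<alpha> i) \<in> weight_vector ` roots" for i k
  proof -
    obtain b where b: "real k *\<^sub>R weight_vector (\<alpha> i) = weight_vector b" "b \<in> roots"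
      using k by (rule imageE)
    have "weight_vector (zsmul (int k) (\<alpha> i)) = weight_vector b"
      using b(1) by (simp add: weight_vector_zsmul)
    then have "zsmul 1 b = zsmul (int k) (\<alpha> i)" using weight_vector_inj by (simp add: zsmul_one)
    from reduced[OF simple_root[OF i] b(2) _ this] have "b = \<alpha> i \<or> b = - \<alpha> i" by simp
    then have "real k *\<^sub>R weight_vector (\<alpha> i) = weight_vector (\<alpha> i)
        \<or> real k *\<^sub>R weight_vector (\<alpha> i) = (- 1) *\<^sub>R weight_vector (\<alpha> i)"
      using b(1) by (auto simp: weight_vector_uminus)
    then show ?thesis using coroot_vector(1)[OF simple_root[OF i]]
      by (auto simp only: scaleR_cancel_right scaleR_one)
        (metis scaleR_cancel_right scaleR_one of_nat_eq_1_iff)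
  qed
qed

text \<open>Every root is an integral combination of simple roots, and coroots are proportional to roots; so a
  character that vanishes on the simple coroots vanishes on all of them.\<close>

lemma D_characterI:
  assumes "\<And>j. j \<in> {1..l} \<Longrightarrow> pr \<mu> (coroot (\<alpha> j)) = 0"
  shows "\<mu> \<in> D_characters pr roots coroot"
proof -
  have simple: "weight_vector \<mu> \<bullet> weight_vector (\<alpha> j) = 0" if "j \<in> {1..l}" for j
    using pr_coroot[OF simple_root[OF that], of \<mu>] assms[OF that]
      root_vector_pos[OF simple_root[OF that]] by simp
  have coroot: "pr \<mu> (coroot \<beta>) = 0" if \<beta>: "\<beta> \<in> roots" for \<beta>
  proof -
    obtain m :: "nat \<Rightarrow> nat" where "weight_vector \<beta> = (\<Sum>i\<in>{1..l}. real (m i) *\<^sub>R weight_vector (\<alpha> i))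
      \<or> weight_vector \<beta> = - (\<Sum>i\<in>{1..l}. real (m i) *\<^sub>R weight_vector (\<alpha> i))"
      using system.positive_or_negative[OF imageI[OF \<beta>]] by blast
    then have "weight_vector \<mu> \<bullet> weight_vector \<beta> = 0"
      using simple by (auto simp: inner_sum_right)
    then have "real_of_int (pr \<mu> (coroot \<beta>)) = 0" unfolding pr_coroot[OF \<beta>] by simp
    then show ?thesis by simp
  qed
  have "pr \<mu> y = 0" if "y \<in> zmod.span (coroot ` roots)" for y
    using that
  proof (induction rule: zmod.span_induct)
    case base
    have "rp \<mu> (\<iota> (zsmul k y)) = of_int k * rp \<mu> (\<iota> y)" for k y
      using rp_linear[of \<mu>] by (simp add: iota_zsmul linear_scale)
    then have "real_of_int (pr \<mu> (zsmul k y)) = real_of_int (k * pr \<mu> y)" for k y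
      by (simp only: rp_iota of_int_mult)
    then have "pr \<mu> (zsmul k y) = k * pr \<mu> y" for k y by (simp only: of_int_eq_iff)
    moreover have "pr \<mu> 0 = 0" using pr_add_right[of \<mu> 0 0] by simp
    ultimately show ?case by (simp add: zmod.subspace_def pr_add_right)
  qed (use coroot in auto)
  then show ?thesis
    using sc unfolding D_characters_def sc_derived_def coroot_lattice_def by simp
qed

text \<open>The correction of \<open>\<mu>\<close> by fundamental weights that makes it vanish on the simple coroots, and hence a
  character of \<open>D\<close>.\<close>

definition central_component :: "'x \<Rightarrow> 'x" where
  "central_component \<mu> = \<mu> - (\<Sum>j\<in>{1..l}. zsmul (pr \<mu> (coroot (\<alpha> j))) (\<omega> j))"

lemma central_component_add: "central_component (\<mu> + \<mu>') = central_component \<mu> + central_component \<mu>'"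
  by (simp add: central_component_def pr_add_left zsmul_add_left sum.distrib)

lemma rp_central_component:
  "rp (central_component \<mu>) x = rp \<mu> x - (\<Sum>j\<in>{1..l}. of_int (pr \<mu> (coroot (\<alpha> j))) * rp (\<omega> j) x)"
  by (simp add: central_component_def weight_vector_diff weight_vector_sum weight_vector_zsmul
      inner_diff_left inner_sum_left flip: weight_vector_inner)

lemma central_component_span: "central_component \<mu> \<in> zmod.span (\<omega> ` {l+1..n})"
proof -
  have "pr (central_component \<mu>) (coroot (\<alpha> k)) = 0" if k: "k \<in> {1..l}" for k
  proof -
    have "(\<Sum>j\<in>{1..l}. of_int (pr \<mu> (coroot (\<alpha> j))) * rp (\<omega> j) (\<iota> (coroot (\<alpha> k))))
        = (\<Sum>j\<in>{1..l}. if j = k then real_of_int (pr \<mu> (coroot (\<alpha> k))) else 0)"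
      by (rule sum.cong) (use k fundamental in \<open>auto simp: rp_iota\<close>)
    then have "real_of_int (pr (central_component \<mu>) (coroot (\<alpha> k))) = 0"
      using rp_central_component[of \<mu> "\<iota> (coroot (\<alpha> k))"] k by (simp add: rp_iota)
    then show ?thesis by simp
  qed
  then have "central_component \<mu> \<in> D_characters pr roots coroot" by (rule D_characterI)
  then show ?thesis using central unfolding z_basis_of_def by simp
qed

lemma weights_separate:
  assumes "\<And>j. j \<in> {1..l} \<union> {l+1..n} \<Longrightarrow> rp (\<omega> j) x = 0"
  shows "x = 0"
proof (rule rp_separates)
  fix \<mu>
  have "rp 0 x = 0" using rp_add_weight[of 0 0 x] by simp
  then have "zmod.subspace {\<mu>'. rp \<mu>' x = 0}"
    by (simp add: zmod.subspace_def rp_add_weight rp_zsmul_weight)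
  moreover have "\<omega> ` {l+1..n} \<subseteq> {\<mu>'. rp \<mu>' x = 0}" using assms by blast
  ultimately have "zmod.span (\<omega> ` {l+1..n}) \<subseteq> {\<mu>'. rp \<mu>' x = 0}" by (intro zmod.span_minimal)
  then have "rp (central_component \<mu>) x = 0" using central_component_span by blast
  then show "rp \<mu> x = rp \<mu> 0"
    using rp_central_component[of \<mu> x] assms linear_0[OF rp_linear[of \<mu>]] by simp
qed

text \<open>The vectors of the simple roots are linearly independent, in a space spanned by \<open>n\<close> vectors.\<close>

lemma l_le_n: "l \<le> n"
proof -
  let ?e = "\<lambda>i. weight_vector (\<alpha> i)"
  have inj: "inj_on ?e {1..l}"
    by (rule inj_onI) (metis weight_vector_inj inj_simple inj_on_eq_iff)
  have "independent (?e ` {1..l})"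
  proof
    assume "dependent (?e ` {1..l})"
    then obtain u where u: "\<exists>v\<in>?e ` {1..l}. u v \<noteq> 0" "(\<Sum>v\<in>?e ` {1..l}. u v *\<^sub>R v) = 0"
      unfolding dependent_finite[OF finite_imageI[OF finite_atLeastAtMost]] by blast
    have "(\<Sum>i\<in>{1..l}. u (?e i) *\<^sub>R ?e i) = 0"
      using u(2) unfolding sum.reindex[OF inj] by simp
    from system.independent_simple[OF this] u(1) show False by auto
  qed
  moreover obtain B y where B: "finite B" "card B = n" "\<forall>x. (\<Sum>b\<in>B. rp b x *\<^sub>R \<iota> (y b)) = x"
    using real_expansion_exists by blast
  have span: "x \<in> span ((\<lambda>b. \<iota> (y b)) ` B)" for x
  proof -
    have "(\<Sum>b\<in>B. rp b x *\<^sub>R \<iota> (y b)) \<in> span ((\<lambda>b. \<iota> (y b)) ` B)"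
      by (intro span_sum span_scale span_base imageI)
    then show ?thesis using B(3) by simp
  qed
  ultimately have "card (?e ` {1..l}) \<le> card ((\<lambda>b. \<iota> (y b)) ` B)"
    using independent_span_bound[OF finite_imageI[OF B(1)]] by blast
  also have "\<dots> \<le> n" using card_image_le[OF B(1)] B(2) by blast
  finally show ?thesis using card_image[OF inj] by simp
qed

text \<open>The coordinate at \<open>\<omega> i\<close> of the central component is an additive function of the character, so the
  perfect pairing provides a cocharacter.\<close>

lemma central_cocharacter_exists:
  assumes "i \<in> {l+1..n}"
  shows "\<exists>y. \<forall>j\<in>{1..n}. pr (\<omega> j) y = (if j = i then 1 else 0)"
proof -
  let ?R = "zmod.representation (\<omega> ` {l+1..n})"
  have indep: "\<not> zmod.dependent (\<omega> ` {l+1..n})" using central unfolding z_basis_of_def by simp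
  have "Modules.additive (\<lambda>\<mu>. ?R (central_component \<mu>) (\<omega> i))"
    unfolding Modules.additive_def central_component_add
    using zmod.representation_add[OF indep central_component_span central_component_span] by simp
  from perfect_right[OF this] obtain y where y: "\<forall>\<mu>. ?R (central_component \<mu>) (\<omega> i) = pr \<mu> y" by blast
  have "pr (\<omega> j) y = (if j = i then 1 else 0)" if j: "j \<in> {1..n}" for j
  proof (cases "j \<in> {1..l}")
    case True
    have "(\<Sum>k\<in>{1..l}. zsmul (pr (\<omega> j) (coroot (\<alpha> k))) (\<omega> k)) = (\<Sum>k\<in>{1..l}. if k = j then \<omega> j else 0)"
      by (rule sum.cong) (use True fundamental in \<open>auto simp: zsmul_one zsmul_zero\<close>)
    then have "central_component (\<omega> j) = 0" using True by (simp add: central_component_def)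
    then have "pr (\<omega> j) y = 0" using y zmod.representation_zero by metis
    then show ?thesis using True assms by auto
  next
    case False
    then have j': "j \<in> {l+1..n}" using j by auto
    have "central_component (\<omega> j) = \<omega> j"
      using central_weight_coroot[OF j' simple_root] by (simp add: central_component_def zsmul_zero)
    then have "pr (\<omega> j) y = (if \<omega> i = \<omega> j then 1 else 0)"
      using y zmod.representation_basis[OF indep imageI[OF j']] by metis
    then show ?thesis using inj_on_eq_iff[OF inj_central assms j'] by auto
  qed
  then show ?thesis by blast
qed

text \<open>The basis of the cocharacters dual to \<open>\<omega> 1, \<dots>, \<omega> n\<close>; its first \<open>l\<close> members are the simple coroots.\<close>

definition dual_coweight :: "nat \<Rightarrow> 'y" where
  "dual_coweight i = (if i \<in> {1..l} then coroot (\<alpha> i)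
     else (SOME y. \<forall>j\<in>{1..n}. pr (\<omega> j) y = (if j = i then 1 else 0)))"

lemma pr_dual_coweight:
  assumes "i \<in> {1..n}" "j \<in> {1..n}"
  shows "pr (\<omega> j) (dual_coweight i) = (if j = i then 1 else 0)"
proof (cases "i \<in> {1..l}")
  case True
  show ?thesis
  proof (cases "j \<in> {1..l}")
    case True
    then show ?thesis using \<open>i \<in> {1..l}\<close> fundamental[of j i] by (simp add: dual_coweight_def)
  next
    case False
    then have "j \<in> {l+1..n}" using assms by auto
    then show ?thesis using True False central_weight_coroot simple_root
      by (auto simp: dual_coweight_def)
  qed
next
  case False
  then have "i \<in> {l+1..n}" using assms by auto
  from someI_ex[OF central_cocharacter_exists[OF this]] show ?thesis
    using assms(2) unfolding dual_coweight_def if_not_P[OF False] by (rule bspec)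
qed

lemma weight_dual_inner:
  "i \<in> {1..n} \<Longrightarrow> j \<in> {1..n} \<Longrightarrow> weight_vector (\<omega> i) \<bullet> \<iota> (dual_coweight j) = (if i = j then 1 else 0)"
  by (simp add: weight_vector_inner rp_iota pr_dual_coweight)

lemma weight_expansion: "(\<Sum>i\<in>{1..n}. (weight_vector (\<omega> i) \<bullet> x) *\<^sub>R \<iota> (dual_coweight i)) = x" (is "?s = x")
proof -
  have "rp (\<omega> j) (?s - x) = 0" if j: "j \<in> {1..l} \<union> {l+1..n}" for j
  proof -
    have j: "j \<in> {1..n}" using j l_le_n by auto
    have "weight_vector (\<omega> j) \<bullet> ?s = (\<Sum>i\<in>{1..n}. if i = j then weight_vector (\<omega> j) \<bullet> x else 0)"
      unfolding inner_sum_right by (rule sum.cong) (use j weight_dual_inner in auto)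
    also have "\<dots> = weight_vector (\<omega> j) \<bullet> x" using j by simp
    finally show ?thesis by (simp add: inner_diff_right flip: weight_vector_inner)
  qed
  from weights_separate[OF this] show ?thesis by simp
qed

lemma simple_coroot_vector:
  "i \<in> {1..l} \<Longrightarrow> \<iota> (dual_coweight i)
     = (2 / (weight_vector (\<alpha> i) \<bullet> weight_vector (\<alpha> i))) *\<^sub>R weight_vector (\<alpha> i)"
  using coroot_vector(2)[OF simple_root] by (simp add: dual_coweight_def)

lemma simple_coroot_inner_sign:
  assumes "i \<in> {1..l}"
  shows "0 \<le> \<iota> (dual_coweight i) \<bullet> x \<longleftrightarrow> 0 \<le> weight_vector (\<alpha> i) \<bullet> x"
    and "0 < \<iota> (dual_coweight i) \<bullet> x \<longleftrightarrow> 0 < weight_vector (\<alpha> i) \<bullet> x"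
  using root_vector_pos[OF simple_root[OF assms]]
  unfolding simple_coroot_vector[OF assms]
  by (simp_all add: zero_le_mult_iff zero_less_mult_iff zero_le_divide_iff zero_less_divide_iff
      not_less not_le del: inner_gt_zero_iff)

text \<open>The simple coroots are positive multiples of the simple roots, so they are normals of the walls of
  the dominant chamber, and the sign condition on the coordinates is \<open>system.dominant_coefficients_nonneg\<close>.\<close>

sublocale frame: dual_frame rp \<alpha> \<omega> l n "\<lambda>i. \<iota> (dual_coweight i)" "\<lambda>i. weight_vector (\<omega> i)"
proof unfold_locales
  show "l \<le> n" by (rule l_le_n)
  show "rp (\<omega> i) x = weight_vector (\<omega> i) \<bullet> x" for i x by (simp add: weight_vector_inner)
  show "x \<in> dominant rp \<alpha> l \<longleftrightarrow> (\<forall>i\<in>{1..l}. 0 \<le> \<iota> (dual_coweight i) \<bullet> x)" for x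
    by (simp only: dominant_def mem_Collect_eq simple_coroot_inner_sign(1) weight_vector_inner cong: ball_cong)
  show "weight_vector (\<omega> i) \<bullet> \<iota> (dual_coweight j) = (if i = j then 1 else 0)"
    if "i \<in> {1..n}" "j \<in> {1..n}" for i j using weight_dual_inner[OF that] .
  show "(\<Sum>i\<in>{1..n}. (weight_vector (\<omega> i) \<bullet> x) *\<^sub>R \<iota> (dual_coweight i)) = x" for x
    by (rule weight_expansion)
  show "0 \<le> weight_vector (\<omega> i) \<bullet> x"
    if central: "\<And>j. j \<in> {l+1..n} \<Longrightarrow> weight_vector (\<omega> j) \<bullet> x = 0"
      and dom: "\<And>j. j \<in> {1..l} \<Longrightarrow> 0 \<le> \<iota> (dual_coweight j) \<bullet> x" and i: "i \<in> {1..l}" for x i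
  proof -
    define c where "c j = (weight_vector (\<omega> j) \<bullet> x) * (2 / (weight_vector (\<alpha> j) \<bullet> weight_vector (\<alpha> j)))" for j
    have "x = (\<Sum>j\<in>{1..n}. (weight_vector (\<omega> j) \<bullet> x) *\<^sub>R \<iota> (dual_coweight j))"
      by (rule weight_expansion[symmetric])
    also have "\<dots> = (\<Sum>j\<in>{1..l}. (weight_vector (\<omega> j) \<bullet> x) *\<^sub>R \<iota> (dual_coweight j))"
      by (rule sum.mono_neutral_right) (use l_le_n central in auto)
    also have "\<dots> = (\<Sum>j\<in>{1..l}. c j *\<^sub>R weight_vector (\<alpha> j))"
      by (rule sum.cong) (simp_all add: simple_coroot_vector c_def)
    finally have x: "x = (\<Sum>j\<in>{1..l}. c j *\<^sub>R weight_vector (\<alpha> j))" .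
    have "0 \<le> c i"
      by (rule system.dominant_coefficients_nonneg[OF x _ i])
        (use dom simple_coroot_inner_sign(1) in blast)
    then show ?thesis using root_vector_pos[OF simple_root[OF i]]
      by (simp add: c_def zero_le_mult_iff zero_le_divide_iff not_le del: inner_gt_zero_iff)
  qed
qed

lemma in_dominant_iff_simple: "x \<in> dominant rp \<alpha> l \<longleftrightarrow> (\<forall>i\<in>{1..l}. 0 \<le> weight_vector (\<alpha> i) \<bullet> x)"
  by (simp add: dominant_def weight_vector_inner)

lemma weyl_orbit_eq: "(\<lambda>w. weyl_act rp w x) ` weyl_group pr roots coroot
    = (\<lambda>u. u x) ` mirror_group (weight_vector ` roots)"
proof (intro equalityI subsetI; elim imageE)
  fix z w assume z: "z = weyl_act rp w x" "w \<in> weyl_group pr roots coroot"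
  then obtain u where "u \<in> mirror_group (weight_vector ` roots)" "weyl_pair w u"
    using weyl_group_mirror by blast
  then show "z \<in> (\<lambda>u. u x) ` mirror_group (weight_vector ` roots)"
    using z unfolding weyl_pair_def by (intro image_eqI[of _ _ u]) simp_all
next
  fix z u assume z: "z = u x" "u \<in> mirror_group (weight_vector ` roots)"
  then obtain w where "w \<in> weyl_group pr roots coroot" "weyl_pair w u"
    using mirror_weyl_group by blast
  then show "z \<in> (\<lambda>w. weyl_act rp w x) ` weyl_group pr roots coroot"
    using z unfolding weyl_pair_def by (intro image_eqI[of _ _ w]) simp_all
qed

lemma weight_orbit_eq: "weight_vector ` (\<lambda>w. w \<mu>) ` weyl_group pr roots coroot
    = (\<lambda>u. u (weight_vector \<mu>)) ` mirror_group (weight_vector ` roots)"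
proof (intro equalityI subsetI; elim imageE; hypsubst)
  fix w assume w: "w \<in> weyl_group pr roots coroot"
  then obtain u where "u \<in> mirror_group (weight_vector ` roots)" "weyl_pair w u"
    using weyl_group_mirror by blast
  then show "weight_vector (w \<mu>) \<in> (\<lambda>u. u (weight_vector \<mu>)) ` mirror_group (weight_vector ` roots)"
    unfolding weyl_pair_def by (intro image_eqI[of _ _ u]) simp_all
next
  fix u assume u: "u \<in> mirror_group (weight_vector ` roots)"
  then obtain w where w: "w \<in> weyl_group pr roots coroot" "weyl_pair w u"
    using mirror_weyl_group by blast
  then have "u (weight_vector \<mu>) = weight_vector (w \<mu>)" by (simp add: weyl_pair_def)
  then show "u (weight_vector \<mu>) \<in> weight_vector ` (\<lambda>w. w \<mu>) ` weyl_group pr roots coroot"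
    using w(1) by blast
qed

text \<open>Sums over an infinite set are \<open>0\<close>, so finiteness is what gives the components of the adjoint
  quotient their intended meaning.\<close>

lemma finite_weight_orbit: "finite ((\<lambda>w. w \<mu>) ` weyl_group pr roots coroot)"
proof (rule finite_imageD)
  show "finite (weight_vector ` (\<lambda>w. w \<mu>) ` weyl_group pr roots coroot)"
    unfolding weight_orbit_eq by (rule system.finite_mirror_orbit)
  show "inj_on weight_vector ((\<lambda>w. w \<mu>) ` weyl_group pr roots coroot)"
    by (rule inj_onI) (rule weight_vector_inj)
qed

lemma central_weight_orbit:
  assumes "i \<in> {l+1..n}"
  shows "(\<lambda>w. w (\<omega> i)) ` weyl_group pr roots coroot = {\<omega> i}"
proof -
  have "w (\<omega> i) = \<omega> i" if "w \<in> weyl_group pr roots coroot" for w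
    using that
  proof (induction rule: weyl_group.induct)
    case (step w \<beta>)
    then show ?case using central_weight_coroot[OF assms step.hyps(2)]
      by (simp add: reflection_def zsmul_zero)
  qed simp
  then have "(\<lambda>w. w (\<omega> i)) ` weyl_group pr roots coroot = (\<lambda>w. \<omega> i) ` weyl_group pr roots coroot"
    by (intro image_cong refl)
  also have "\<dots> = {\<omega> i}" by (rule image_constant[OF weyl_group.one])
  finally show ?thesis .
qed

end

section \<open>Valuations of the orbit sums\<close>

locale valued_torus_point = weighted_torus pr roots coroot n \<alpha> l \<omega> \<iota> rp + neg_valuation \<pi> v
  for pr :: "'x::ab_group_add \<Rightarrow> 'y::ab_group_add \<Rightarrow> int"
    and roots :: "'x set" and coroot :: "'x \<Rightarrow> 'y" and n :: nat
    and \<alpha> :: "nat \<Rightarrow> 'x" and l :: nat and \<omega> :: "nat \<Rightarrow> 'x"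
    and \<iota> :: "'y \<Rightarrow> 'v::{real_inner, heine_borel}" and rp :: "'x \<Rightarrow> 'v \<Rightarrow> real"
    and \<pi> :: "'o::idom" and v :: "'o fract alg_closure \<Rightarrow> rat" +
  fixes a :: "'x \<Rightarrow> 'o fract alg_closure"
  assumes torus_point: "a \<in> torus_points"
begin

abbreviation \<nu> :: 'v where "\<nu> \<equiv> nu rp v a"

lemma character_nonzero: "a \<mu> \<noteq> 0"
  using torus_point unfolding torus_points_def by blast

lemma rp_nu: "rp \<mu> \<nu> = of_rat (v (a \<mu>))"
proof -
  have "v (a (\<mu> + \<mu>')) = v (a \<mu>) + v (a \<mu>')" for \<mu> \<mu>'
    using torus_point v_mult[OF character_nonzero character_nonzero] unfolding torus_points_def by simp
  then obtain x where x: "\<forall>\<mu>. rp \<mu> x = of_rat (v (a \<mu>))"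
    using additive_represented[of "\<lambda>\<mu>. of_rat (v (a \<mu>))"] by (auto simp: of_rat_add)
  have "\<nu> = x" unfolding nu_def
    by (rule the_equality) (use x rp_separates in auto)
  then show ?thesis using x by simp
qed

lemma val_character: "val v (a \<mu>) = ereal (weight_vector \<mu> \<bullet> \<nu>)"
  by (simp add: val_def character_nonzero rp_nu weight_vector_inner)

definition orbit :: "nat \<Rightarrow> 'x set" where
  "orbit i = (\<lambda>w. w (\<omega> i)) ` weyl_group pr roots coroot"

lemma simple_weight_inner_nonneg:
  assumes "i \<in> {1..l}" "j \<in> {1..l}"
  shows "0 \<le> weight_vector (\<alpha> j) \<bullet> weight_vector (\<omega> i)"
    and "j \<noteq> i \<Longrightarrow> weight_vector (\<alpha> j) \<bullet> weight_vector (\<omega> i) = 0"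
  using weight_vector_simple_inner[OF assms] by (auto simp: inner_commute)

text \<open>From here on \<open>x = u \<nu>\<close> is a dominant point of the orbit of \<open>\<nu>\<close>. As \<open>u\<close> is an isometry that permutes
  the vectors of each orbit of characters, valuations of characters can be computed at \<open>x\<close>.\<close>

context
  fixes u x
  assumes u: "u \<in> mirror_group (weight_vector ` roots)" and x: "x = u \<nu>" "x \<in> dominant rp \<alpha> l"
begin

lemma val_character_moved: "val v (a \<mu>) = ereal (u (weight_vector \<mu>) \<bullet> x)"
  unfolding val_character x(1) mirror_group_inner[OF u] ..

lemma moved_orbit:
  assumes "\<mu> \<in> orbit i"
  obtains w where "w \<in> mirror_group (weight_vector ` roots)" "u (weight_vector \<mu>) = w (weight_vector (\<omega> i))"
proof -
  have "weight_vector \<mu> \<in> (\<lambda>w. w (weight_vector (\<omega> i))) ` mirror_group (weight_vector ` roots)"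
    using assms unfolding orbit_def weight_orbit_eq[symmetric] by (rule imageI)
  then obtain w where "w \<in> mirror_group (weight_vector ` roots)"
    "weight_vector \<mu> = w (weight_vector (\<omega> i))" by blast
  then show ?thesis using mirror_group_comp[OF u] by (intro that[of "u \<circ> w"]) auto
qed

lemma val_orbit_sum_le:
  assumes "i \<in> {1..l}"
  shows "val v (sum a (orbit i)) \<le> ereal (weight_vector (\<omega> i) \<bullet> x)"
proof (rule val_sum_le)
  fix \<mu> assume "\<mu> \<in> orbit i"
  then obtain w where w: "w \<in> mirror_group (weight_vector ` roots)"
    "u (weight_vector \<mu>) = w (weight_vector (\<omega> i))" by (rule moved_orbit)
  have "w (weight_vector (\<omega> i)) \<bullet> x \<le> weight_vector (\<omega> i) \<bullet> x"
    using system.dominant_orbit_inner_le[OF w(1)] simple_weight_inner_nonneg(1)[OF assms] x(2)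
    unfolding in_dominant_iff_simple by blast
  then show "val v (a \<mu>) \<le> ereal (weight_vector (\<omega> i) \<bullet> x)"
    unfolding val_character_moved w(2) by simp
qed

text \<open>The character whose vector \<open>u\<close> moves to that of \<open>\<omega> i\<close> has the largest valuation, and no other
  character of the orbit reaches it because \<open>x\<close> lies off the wall of \<open>\<alpha> i\<close>.\<close>

lemma val_orbit_sum_eq:
  assumes i: "i \<in> {1..l}" and pos: "0 < weight_vector (\<alpha> i) \<bullet> x"
  shows "val v (sum a (orbit i)) = ereal (weight_vector (\<omega> i) \<bullet> x)"
proof -
  obtain u' where u': "u' \<in> mirror_group (weight_vector ` roots)" "\<forall>y. u (u' y) = y"
    using mirror_group_right_inverse[OF u] by blast
  have "u' (weight_vector (\<omega> i)) \<in> weight_vector ` orbit i"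
    unfolding orbit_def weight_orbit_eq using u'(1) by blast
  then obtain \<mu>0 where \<mu>0: "\<mu>0 \<in> orbit i" "weight_vector \<mu>0 = u' (weight_vector (\<omega> i))" by force
  have top: "val v (a \<mu>0) = ereal (weight_vector (\<omega> i) \<bullet> x)"
    unfolding val_character_moved \<mu>0(2) using u'(2) by simp
  have "val v (a \<mu>) < val v (a \<mu>0)" if \<mu>: "\<mu> \<in> orbit i" "\<mu> \<noteq> \<mu>0" for \<mu>
  proof -
    obtain w where w: "w \<in> mirror_group (weight_vector ` roots)"
      "u (weight_vector \<mu>) = w (weight_vector (\<omega> i))" using \<mu>(1) by (rule moved_orbit)
    have "w (weight_vector (\<omega> i)) \<noteq> weight_vector (\<omega> i)"
    proof
      assume "w (weight_vector (\<omega> i)) = weight_vector (\<omega> i)"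
      then have "u (weight_vector \<mu> - weight_vector \<mu>0) = 0"
        using w(2) u'(2) \<mu>0(2) linear_mirror_group[OF u] by (simp add: linear_diff)
      then have "(weight_vector \<mu> - weight_vector \<mu>0) \<bullet> (weight_vector \<mu> - weight_vector \<mu>0) = 0"
        using mirror_group_inner[OF u, of "weight_vector \<mu> - weight_vector \<mu>0"] by (metis inner_zero_left)
      then have "weight_vector \<mu> = weight_vector \<mu>0" by simp
      then show False using weight_vector_inj \<mu>(2) by blast
    qed
    then have "w (weight_vector (\<omega> i)) \<bullet> x < weight_vector (\<omega> i) \<bullet> x"
      using system.fundamental_orbit_inner_less[OF w(1), of "weight_vector (\<omega> i)" i x]
        simple_weight_inner_nonneg[OF i] x(2) i pos
      unfolding in_dominant_iff_simple by blast
    moreover have "val v (a \<mu>) = ereal (w (weight_vector (\<omega> i)) \<bullet> x)"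
      unfolding val_character_moved w(2) ..
    ultimately show ?thesis unfolding top by simp
  qed
  then have "val v (sum a (orbit i)) = val v (a \<mu>0)"
    using finite_weight_orbit \<mu>0(1) character_nonzero
    by (intro val_sum_unique_max) (simp_all add: orbit_def)
  then show ?thesis unfolding top .
qed

lemma val_central_sum:
  assumes "i \<in> {l+1..n}"
  shows "val v (sum a (orbit i)) = ereal (weight_vector (\<omega> i) \<bullet> x)"
proof -
  have orb: "orbit i = {\<omega> i}" unfolding orbit_def by (rule central_weight_orbit[OF assms])
  obtain w where w: "w \<in> weyl_group pr roots coroot" "weyl_pair w u" using mirror_weyl_group[OF u] by blast
  have "w (\<omega> i) \<in> orbit i" unfolding orbit_def using w(1) by blast
  then have "u (weight_vector (\<omega> i)) = weight_vector (\<omega> i)"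
    using w(2) unfolding orb weyl_pair_def by (metis singletonD)
  then show ?thesis unfolding orb using val_character_moved[of "\<omega> i"] by simp
qed

text \<open>The valuations of the orbit sums satisfy the conditions of \<open>retraction_truncation_eqI\<close> for \<open>x\<close>.\<close>

lemma extended_retraction_d_point:
  "extended_retraction rp \<alpha> l \<omega> n (d_point v n (adjoint_quotient pr roots coroot \<omega> a)) = x"
proof -
  let ?d = "d_point v n (adjoint_quotient pr roots coroot \<omega> a)"
  have d: "?d i = val v (sum a (orbit i))" if "i \<in> {1..n}" for i
    using that by (simp add: d_point_def adjoint_quotient_def orbit_def)
  have central: "?d i = ereal (weight_vector (\<omega> i) \<bullet> x)" if "i \<in> {l+1..n}" for i
    using d[of i] val_central_sum[OF that] that by simp
  have small: "i \<in> {1..n}" if "i \<in> {1..l}" for i using that l_le_n by simp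
  have "?d \<in> extended_space l n"
    unfolding extended_space_def mem_Collect_eq
  proof (intro conjI ballI allI impI)
    show "?d i \<noteq> \<infinity>" if "i \<in> {1..l}" for i
      unfolding d[OF small[OF that]] by (simp add: val_def)
    show "\<bar>?d i\<bar> \<noteq> \<infinity>" if "i \<in> {l+1..n}" for i unfolding central[OF that] by simp
    show "?d i = 0" if "i \<notin> {1..n}" for i using that unfolding d_point_def by (rule if_not_P)
  qed
  moreover have "retraction_dom rp \<alpha> l (frame.truncation ?d) = x"
  proof (rule frame.retraction_truncation_eqI[OF x(2)])
    show "?d i = ereal (weight_vector (\<omega> i) \<bullet> x)" if "i \<in> {l+1..n}" for i by (rule central[OF that])
    show "?d i \<le> ereal (weight_vector (\<omega> i) \<bullet> x)" if "i \<in> {1..l}" for i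
      unfolding d[OF small[OF that]] by (rule val_orbit_sum_le[OF that])
    show "?d i = ereal (weight_vector (\<omega> i) \<bullet> x)" if "i \<in> {1..l}" "0 < \<iota> (dual_coweight i) \<bullet> x" for i
      using val_orbit_sum_eq[OF that(1)] that(2)
      unfolding d[OF small[OF that(1)]] simple_coroot_inner_sign(2)[OF that(1)] by blast
  qed
  ultimately show ?thesis unfolding frame.extended_retraction_eq by simp
qed

end

lemma dominant_in_orbit: "\<exists>u\<in>mirror_group (weight_vector ` roots). u \<nu> \<in> dominant rp \<alpha> l"
proof -
  \<comment> \<open>The sum of the fundamental weights lies in the interior of the dominant chamber.\<close>
  let ?f = "\<Sum>i\<in>{1..l}. weight_vector (\<omega> i)"
  have "0 < weight_vector (\<alpha> j) \<bullet> ?f" if j: "j \<in> {1..l}" for j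
  proof -
    have "weight_vector (\<alpha> j) \<bullet> ?f
        = (\<Sum>i\<in>{1..l}. if i = j then (weight_vector (\<alpha> j) \<bullet> weight_vector (\<alpha> j)) / 2 else 0)"
      unfolding inner_sum_right
      by (rule sum.cong) (use j weight_vector_simple_inner in \<open>auto simp: inner_commute\<close>)
    also have "\<dots> = (weight_vector (\<alpha> j) \<bullet> weight_vector (\<alpha> j)) / 2" using j by simp
    finally show ?thesis using root_vector_pos[OF simple_root[OF j]] by linarith
  qed
  from system.dominant_in_mirror_orbit[OF this] show ?thesis
    unfolding in_dominant_iff_simple .
qed

end

theorem theorem1p5p1:
  fixes \<pi> :: "'o::idom"
    and v :: "'o fract alg_closure \<Rightarrow> rat"
    and pr :: "'x::ab_group_add \<Rightarrow> 'y::ab_group_add \<Rightarrow> int"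
    and roots :: "'x set" and coroot :: "'x \<Rightarrow> 'y"
    and \<alpha> \<omega> :: "nat \<Rightarrow> 'x" and l n :: nat
    and \<iota> :: "'y \<Rightarrow> 'v::{real_inner, heine_borel}"
    and rp :: "'x \<Rightarrow> 'v \<Rightarrow> real"
    and a :: "'x \<Rightarrow> 'o fract alg_closure"
  assumes "neg_valuation \<pi> v"
    and "adapted_weights pr roots coroot n \<alpha> l \<omega>"
    and "real_cocharacters pr roots coroot n \<iota> rp"
    and "a \<in> torus_points"
  shows "{x \<in> (\<lambda>w. weyl_act rp w (nu rp v a)) ` weyl_group pr roots coroot.
            x \<in> dominant rp \<alpha> l} =
         {extended_retraction rp \<alpha> l \<omega> n
            (d_point v n (adjoint_quotient pr roots coroot \<omega> a))}"
proof -
  interpret valued_torus_point pr roots coroot n \<alpha> l \<omega> \<iota> rp \<pi> v a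
    by (intro valued_torus_point.intro weighted_torus.intro valued_torus_point_axioms.intro assms)
  let ?r = "extended_retraction rp \<alpha> l \<omega> n (d_point v n (adjoint_quotient pr roots coroot \<omega> a))"
  let ?S = "{x \<in> (\<lambda>u. u \<nu>) ` mirror_group (weight_vector ` roots). x \<in> dominant rp \<alpha> l}"
  have unique: "x = ?r" if "x \<in> (\<lambda>u. u \<nu>) ` mirror_group (weight_vector ` roots)" "x \<in> dominant rp \<alpha> l" for x
    using that extended_retraction_d_point by (elim imageE) metis
  obtain u where "u \<in> mirror_group (weight_vector ` roots)" "u \<nu> \<in> dominant rp \<alpha> l"
    using dominant_in_orbit by blast
  then have member: "u \<nu> \<in> ?S" by simp
  have "?S \<subseteq> {?r}" using unique by (simp add: subset_iff)
  from subset_singletonD[OF this] member have "?S = {?r}" by (metis empty_iff)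
  then show ?thesis unfolding weyl_orbit_eq .
qed

end
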